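(* Let $D\ge1$ be an integer and let $\vec p$ be a single-edge strategy such that $\sigma_{\vec p}$ is an extreme point of the convex set $\{\sigma_{\vec q}:\vec q\text{ a single-edge strategy}\}$. Then the grid entropy of $\sigma_{\vec p}$ is $\|\sigma_{\vec p}\|=0$.
   Context: $\Lambda$ is Lebesgue measure on $[0,1]$; $\mathcal M_1$ is the space of Borel probability measures on $[0,1]$. A single-edge strategy is a vector $\vec p=(p_1,\dots,p_D)$ of measurable functions $p_k:[0,1]^D\to[0,1]$ with $\sum_{k}p_k\equiv1$. If $U^1,\dots,U^D$ are i.i.d. Unif$[0,1]$ and, given $(U^1,\dots,U^D)=(u_1,\dots,u_D)$, the index $J$ equals $k$ with probability $p_k(u_1,\dots,u_D)$, then $\sigma_{\vec p}$ denotes the law of $U^J$. Grid entropy. Let $(U_i^j)_{i\ge0,1\le j\le D}$ be i.i.d. Unif$[0,1]$. A path $\pi:0\to n$ is a sequence $(j_0,\dots,j_{n-1})\in\{1,\dots,D\}^n$, with $\frac1n\mu_\pi=\frac1n\sum_{i=0}^{n-1}\delta_{U_i^{j_i}}$. Let $\rho$ be the Levy-Prokhorov metric: $\rho(\mu,\nu)=\inf\{\epsilon>0:\mu(A)\le\nu(A^\epsilon)+\epsilon\text{ and }\nu(A)\le\mu(A^\epsilon)+\epsilon\ \forall A\text{ Borel}\}$, $A^\epsilon$ being the $\epsilon$-neighbourhood of $A$. For $\nu\in\mathcal M_1$ let $\min^k_{\pi:0\to n}\rho(\frac1n\mu_\pi,\nu)$ be the $k$-th smallest of the $D^n$ values $\rho(\frac1n\mu_\pi,\nu)$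 (counted with multiplicity), and $+\infty$ if $k>D^n$. The grid entropy of $\nu$ is $$\|\nu\|=\sup\Big\{\alpha\ge0:\lim_{n\to\infty}\min^{\lfloor e^{\alpha n}\rfloor}_{\pi:0\to n}\rho\big(\tfrac1n\mu_\pi,\nu\big)=0\text{ a.s.}\Big\},$$ with value $-\infty$ if the set of $\alpha$'s is empty. *)

theory Defs
  imports "HOL-Probability.Probability"
begin

(* The uniform law on [0,1], living on [0,1] with its Borel sigma-algebra (not on the whole
   real line), so that Borel measures on [0,1] are the measures with the same "sets". *)
definition unif01 :: "real measure" where
  "unif01 = restrict_space lborel {0..1}"

definition single_edge_strategy :: "nat \<Rightarrow> (nat \<Rightarrow> (nat \<Rightarrow> real) \<Rightarrow> real) \<Rightarrow> bool" where
  "single_edge_strategy D p \<longleftrightarrow>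
     (\<forall>k\<in>{1..D}. p k \<in> borel_measurable (Pi\<^sub>M {1..D} (\<lambda>_. unif01))) \<and>
     (\<forall>u\<in>space (Pi\<^sub>M {1..D} (\<lambda>_. unif01)).
        (\<forall>k\<in>{1..D}. 0 \<le> p k u \<and> p k u \<le> 1) \<and> (\<Sum>k\<in>{1..D}. p k u) = 1)"

(* The joint law of ((U^1,...,U^D), J) has density (u, k) |-> p_k(u) with respect to the product
   of the uniform law on the cube and counting measure; the result is its image under
   (u, k) |-> u_k, that is, the law of U^J. *)
definition strategy_law :: "nat \<Rightarrow> (nat \<Rightarrow> (nat \<Rightarrow> real) \<Rightarrow> real) \<Rightarrow> real measure" where
  "strategy_law D p =
     distr (density (Pi\<^sub>M {1..D} (\<lambda>_. unif01) \<Otimes>\<^sub>M count_space {1..D})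
                    (\<lambda>(u, k). ennreal (p k u)))
           unif01 (\<lambda>(u, k). u k)"

(* Same shape as extreme_point_of, which is not applicable because measures do not form an
   instance of real_vector: x lies in no open segment between two distinct points of S. *)
definition extreme_measure_of :: "'a measure \<Rightarrow> 'a measure set \<Rightarrow> bool" where
  "extreme_measure_of \<sigma> S \<longleftrightarrow>
     \<sigma> \<in> S \<and>
     \<not> (\<exists>\<mu>\<in>S. \<exists>\<nu>\<in>S. \<exists>t::real. \<mu> \<noteq> \<nu> \<and> 0 < t \<and> t < 1 \<and>
          (\<forall>A\<in>sets \<sigma>. measure \<sigma> A = (1 - t) * measure \<mu> A + t * measure \<nu> A))"

definition levy_prokhorov :: "'a::metric_space measure \<Rightarrow> 'a measure \<Rightarrow> real" where
  "levy_prokhorov \<mu> \<nu> =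
     Inf {\<epsilon>. 0 < \<epsilon> \<and>
            (\<forall>A\<in>sets \<mu>. measure \<mu> A \<le> measure \<nu> ((\<Union>a\<in>A. ball a \<epsilon>) \<inter> space \<mu>) + \<epsilon> \<and>
                         measure \<nu> A \<le> measure \<mu> ((\<Union>a\<in>A. ball a \<epsilon>) \<inter> space \<mu>) + \<epsilon>)}"

(* Independent random variables U i j, i >= 0, 1 <= j <= D, taking values in [0,1] and uniformly
   distributed there; measurability is part of indep_vars. *)
definition iid_uniform_grid ::
    "'w measure \<Rightarrow> nat \<Rightarrow> (nat \<Rightarrow> nat \<Rightarrow> 'w \<Rightarrow> real) \<Rightarrow> bool" where
  "iid_uniform_grid M D U \<longleftrightarrow>
     prob_space M \<and>
     prob_space.indep_vars M (\<lambda>_. unif01) (\<lambda>(i, j). U i j) (UNIV \<times> {1..D}) \<and>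
     (\<forall>i. \<forall>j\<in>{1..D}. distr M unif01 (U i j) = unif01)"

definition grid_paths :: "nat \<Rightarrow> nat \<Rightarrow> (nat \<Rightarrow> nat) set" where
  "grid_paths D n = (\<Pi>\<^sub>E i\<in>{..<n}. {1..D})"

(* (1/n) * sum_{i<n} delta_{x i}, as the image of the uniform law on {0,...,n-1};
   the null measure for n = 0. *)
definition empirical_measure :: "nat \<Rightarrow> (nat \<Rightarrow> real) \<Rightarrow> real measure" where
  "empirical_measure n x = distr (uniform_count_measure {..<n}) unif01 x"

(* Ranks start at 1, and values are counted with multiplicity. *)
definition kth_smallest :: "nat \<Rightarrow> ('a \<Rightarrow> real) \<Rightarrow> 'a set \<Rightarrow> ereal" where
  "kth_smallest k f P =
     (if k \<le> card P
      then ereal (sorted_list_of_multiset (image_mset f (mset_set P)) ! (k - 1))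
      else \<infinity>)"

(* In ereal the supremum of the empty set is -\<infinity>, as required. *)
definition grid_entropy ::
    "'w measure \<Rightarrow> nat \<Rightarrow> (nat \<Rightarrow> nat \<Rightarrow> 'w \<Rightarrow> real) \<Rightarrow> real measure \<Rightarrow> ereal" where
  "grid_entropy M D U \<nu> =
     Sup (ereal ` {\<alpha>. 0 \<le> \<alpha> \<and>
       (AE \<omega> in M.
          (\<lambda>n. kth_smallest (nat \<lfloor>exp (\<alpha> * real n)\<rfloor>)
                 (\<lambda>\<pi>. levy_prokhorov (empirical_measure n (\<lambda>i. U i (\<pi> i) \<omega>)) \<nu>)
                 (grid_paths D n)) \<longlonglongrightarrow> 0)})"

end

theory Submission
  imports Defs
begin

text \<open>Perturbing mass between two choices shows that extremality makes the strategy \<open>p\<close>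
  representing the law unique and deterministic almost everywhere. For the lower bound the path
  that always follows this choice has empirical measures converging to the law.

  For the upper bound, uniqueness is made quantitative by compactness and duality: for every
  \<open>\<delta> > 0\<close> there are a step function \<open>f\<close> on \<open>[0,1]\<close> and a bounded \<open>g\<close> on the cube such that
  \<open>1 - p\<^sub>k(u) \<le> g(u) + f(u\<^sub>k)\<close> and the means of \<open>g\<close> on the cube and of \<open>f\<close> under the law add up to at most \<open>\<delta>\<close>.
  Summing along a path whose empirical measure is close to the law, the law of large numbers
  for \<open>g\<close> bounds the proportion of edges at which the path deviates from \<open>p\<close> by \<open>3 \<delta>\<close>, and
  there are only \<open>exp(o(1) n)\<close> such paths as \<open>\<delta>\<close> tends to \<open>0\<close>.\<close>

text \<open>A path may choose its indices after looking at the whole grid, so no law of large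
  numbers applies to its averages, and uniqueness of \<open>p\<close> among strategies says nothing
  about it directly. The inequality \<open>1 - p\<^sub>k(u) \<le> g(u) + f(u\<^sub>k)\<close> holds
  for every choice \<open>k\<close> and so removes this freedom: the sum of \<open>g\<close> depends
  on the rows only, the sum of \<open>f\<close> only on the empirical measure of the path. The three
  summands of \<open>3 \<delta>\<close> are the slack in the certificate, the deviation of the row
  averages of \<open>g\<close>, and the error from replacing the empirical measure by the law in
  \<open>f\<close>. The last one is controllable although \<open>f\<close> is discontinuous: as
  \<open>p\<^sub>k \<le> 1\<close>, every strategy law has density at most \<open>D\<close>, so its
  distribution function is \<open>D\<close>-Lipschitz and Levy-Prokhorov closeness controls
  half-lines. The step function \<open>f\<close> combines finitely many half-line indicators, which
  is why uniqueness is first upgraded to stability: a strategy that almost agrees with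
  \<open>p\<close> on finitely many half-lines has small mean miss.\<close>

declare One_nat_def [simp del] \<comment> \<open>otherwise \<open>{1..D}\<close> becomes \<open>{Suc 0..D}\<close> and facts about the cube no longer match\<close>

subsection \<open>Strategies and the laws they induce\<close>

abbreviation unif_cube :: "nat \<Rightarrow> (nat \<Rightarrow> real) measure" where
  "unif_cube D \<equiv> Pi\<^sub>M {1..D} (\<lambda>_. unif01)"

text \<open>The expectation of \<open>w J u\<close> with the choice \<open>J\<close> integrated out.
  The reward \<open>w\<close> may depend on the whole row, so this one functional, affine in
  \<open>q\<close>, covers masses of sets, the probability of deviating from \<open>p\<close>, and
  squared norms.\<close>

definition strategy_mean ::
    "nat \<Rightarrow> (nat \<Rightarrow> (nat \<Rightarrow> real) \<Rightarrow> real) \<Rightarrow> (nat \<Rightarrow> (nat \<Rightarrow> real) \<Rightarrow> real) \<Rightarrow> real" where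
  "strategy_mean D q w = (\<integral>u. (\<Sum>k\<in>{1..D}. q k u * w k u) \<partial>unif_cube D)"

definition bounded_reward :: "nat \<Rightarrow> (nat \<Rightarrow> (nat \<Rightarrow> real) \<Rightarrow> real) \<Rightarrow> bool" where
  "bounded_reward D w \<longleftrightarrow>
     (\<forall>k\<in>{1..D}. w k \<in> borel_measurable (unif_cube D)) \<and>
     (\<exists>B. \<forall>k\<in>{1..D}. \<forall>u\<in>space (unif_cube D). \<bar>w k u\<bar> \<le> B)"

lemma space_unif01 [simp]: "space unif01 = {0..1}"
  by (simp add: unif01_def space_restrict_space)

lemma sets_unif01: "sets unif01 = sets (restrict_space borel {0..1})"
  unfolding unif01_def by (rule sets_restrict_space_cong) simp

lemma sets_unif01_iff: "A \<in> sets unif01 \<longleftrightarrow> A \<in> sets borel \<and> A \<subseteq> {0..1}"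
  unfolding sets_unif01 by (subst sets_restrict_space_iff) auto

lemma borel_Int_unif01 [simp]: "A \<in> sets borel \<Longrightarrow> A \<inter> {0..1} \<in> sets unif01"
  by (simp add: sets_unif01_iff)

lemma measurable_unif01_ident [measurable]: "(\<lambda>x. x) \<in> borel_measurable unif01"
  by (subst measurable_cong_sets[OF sets_unif01 refl]) (intro measurable_restrict_space1, simp)

lemma emeasure_unif01: "A \<in> sets unif01 \<Longrightarrow> emeasure unif01 A = emeasure lborel A"
  unfolding unif01_def by (subst emeasure_restrict_space) (auto simp: sets_restrict_space)

lemma prob_space_unif01: "prob_space unif01"
  by (rule prob_spaceI) (simp add: emeasure_unif01 sets_unif01_iff)

lemma prob_space_unif_cube: "prob_space (unif_cube D)"
  by (intro prob_space_PiM prob_space_unif01)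

lemma measurable_unif_cube_coord:
  assumes "k \<in> {1..D}"
  shows "(\<lambda>u. u k) \<in> measurable (unif_cube D) unif01"
    and "(\<lambda>u. u k) \<in> borel_measurable (unif_cube D)"
  using assms measurable_compose[OF measurable_component_singleton[of k "{1..D}" "\<lambda>_. unif01"] measurable_unif01_ident]
  by (auto intro!: measurable_component_singleton)

lemma unif_cube_coord_range: "u \<in> space (unif_cube D) \<Longrightarrow> k \<in> {1..D} \<Longrightarrow> u k \<in> {0..1}"
  by (auto simp: space_PiM PiE_iff)

lemma distr_unif_cube_coord:
  assumes "k \<in> {1..D}"
  shows "distr (unif_cube D) unif01 (\<lambda>u. u k) = unif01"
  by (rule distr_PiM_component) (use assms in \<open>auto intro: prob_space_unif01\<close>)

lemma strategyD:
  assumes "single_edge_strategy D q" "k \<in> {1..D}"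
  shows "q k \<in> borel_measurable (unif_cube D)"
    and "u \<in> space (unif_cube D) \<Longrightarrow> 0 \<le> q k u"
    and "u \<in> space (unif_cube D) \<Longrightarrow> q k u \<le> 1"
  using assms by (auto simp: single_edge_strategy_def)

lemma strategy_sum:
  assumes "single_edge_strategy D q" "u \<in> space (unif_cube D)"
  shows "(\<Sum>k\<in>{1..D}. q k u) = 1"
  using assms by (auto simp: single_edge_strategy_def)

lemma strategyI:
  assumes "\<And>k. k \<in> {1..D} \<Longrightarrow> q k \<in> borel_measurable (unif_cube D)"
    and nn: "\<And>k u. k \<in> {1..D} \<Longrightarrow> u \<in> space (unif_cube D) \<Longrightarrow> 0 \<le> q k u"
    and s: "\<And>u. u \<in> space (unif_cube D) \<Longrightarrow> (\<Sum>k\<in>{1..D}. q k u) = 1"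
  shows "single_edge_strategy D q"
  unfolding single_edge_strategy_def
proof (intro conjI ballI)
  fix u k assume "u \<in> space (unif_cube D)" "k \<in> {1..D}"
  then have "q k u \<le> (\<Sum>k\<in>{1..D}. q k u)"
    using nn by (intro member_le_sum) auto
  then show "q k u \<le> 1" using s[OF \<open>u \<in> _\<close>] by simp
qed (use assms in auto)

lemma strategy_convex_comb:
  assumes "single_edge_strategy D q" "single_edge_strategy D r" "0 \<le> t" "t \<le> (1::real)"
  shows "single_edge_strategy D (\<lambda>k u. (1 - t) * q k u + t * r k u)"
proof (rule strategyI)
  fix k assume "k \<in> {1..D}"
  note [measurable] = strategyD(1)[OF assms(1) this] strategyD(1)[OF assms(2) this]
  show "(\<lambda>u. (1 - t) * q k u + t * r k u) \<in> borel_measurable (unif_cube D)"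
    by measurable
next
  fix k u assume "k \<in> {1..D}" "u \<in> space (unif_cube D)"
  then show "0 \<le> (1 - t) * q k u + t * r k u"
    using assms strategyD(2)[OF assms(1)] strategyD(2)[OF assms(2)] by auto
next
  fix u assume "u \<in> space (unif_cube D)"
  then show "(\<Sum>k\<in>{1..D}. (1 - t) * q k u + t * r k u) = 1"
    using strategy_sum[OF assms(1)] strategy_sum[OF assms(2)]
    by (simp add: sum.distrib flip: sum_distrib_left)
qed

section \<open>Mean rewards of a strategy\<close>

lemma strategy_mean_bounds:
  assumes q: "single_edge_strategy D q" and u: "u \<in> space (unif_cube D)"
    and w: "\<And>k. k \<in> {1..D} \<Longrightarrow> a \<le> w k u \<and> w k u \<le> (b::real)"
  shows "a \<le> (\<Sum>k\<in>{1..D}. q k u * w k u)" "(\<Sum>k\<in>{1..D}. q k u * w k u) \<le> b"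
proof -
  have "(\<Sum>k\<in>{1..D}. q k u * a) \<le> (\<Sum>k\<in>{1..D}. q k u * w k u)"
    using w strategyD(2)[OF q _ u] by (intro sum_mono mult_left_mono) auto
  then show "a \<le> (\<Sum>k\<in>{1..D}. q k u * w k u)"
    using strategy_sum[OF q u] by (simp flip: sum_distrib_right)
  have "(\<Sum>k\<in>{1..D}. q k u * w k u) \<le> (\<Sum>k\<in>{1..D}. q k u * b)"
    using w strategyD(2)[OF q _ u] by (intro sum_mono mult_left_mono) auto
  then show "(\<Sum>k\<in>{1..D}. q k u * w k u) \<le> b"
    using strategy_sum[OF q u] by (simp flip: sum_distrib_right)
qed

lemma strategy_mean_measurable:
  assumes q: "single_edge_strategy D q" and w: "bounded_reward D w"
  shows "(\<lambda>u. \<Sum>k\<in>{1..D}. q k u * w k u) \<in> borel_measurable (unif_cube D)"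
  using strategyD(1)[OF q] w unfolding bounded_reward_def
  by (intro borel_measurable_sum borel_measurable_times) auto

lemma strategy_mean_integrable:
  assumes q: "single_edge_strategy D q" and w: "bounded_reward D w"
  shows "integrable (unif_cube D) (\<lambda>u. \<Sum>k\<in>{1..D}. q k u * w k u)"
proof -
  interpret prob_space "unif_cube D" by (rule prob_space_unif_cube)
  from w obtain B where B: "\<And>k u. k \<in> {1..D} \<Longrightarrow> u \<in> space (unif_cube D) \<Longrightarrow> \<bar>w k u\<bar> \<le> B"
    unfolding bounded_reward_def by blast
  show ?thesis
  proof (rule integrable_const_bound[where B = B])
    show "AE u in unif_cube D. norm (\<Sum>k\<in>{1..D}. q k u * w k u) \<le> B"
    proof (rule AE_I2)
      fix u assume u: "u \<in> space (unif_cube D)"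
      have "- B \<le> w k u \<and> w k u \<le> B" if "k \<in> {1..D}" for k
        using B[OF that u] by auto
      from strategy_mean_bounds[OF q u, where w = w, OF this] show "norm (\<Sum>k\<in>{1..D}. q k u * w k u) \<le> B"
        by auto
    qed
  qed (rule strategy_mean_measurable[OF q w])
qed

lemma strategy_mean_convex_comb:
  assumes q: "single_edge_strategy D q" "single_edge_strategy D r" and w: "bounded_reward D w"
  shows "strategy_mean D (\<lambda>k u. (1 - t) * q k u + t * r k u) w
           = (1 - t) * strategy_mean D q w + t * strategy_mean D r w"
proof -
  have "strategy_mean D (\<lambda>k u. (1 - t) * q k u + t * r k u) w =
      (\<integral>u. (1 - t) * (\<Sum>k\<in>{1..D}. q k u * w k u) + t * (\<Sum>k\<in>{1..D}. r k u * w k u) \<partial>unif_cube D)"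
    unfolding strategy_mean_def
    by (intro Bochner_Integration.integral_cong refl)
       (simp add: sum_distrib_left sum.distrib distrib_right mult.assoc)
  then show ?thesis
    using strategy_mean_integrable[OF q(1) w] strategy_mean_integrable[OF q(2) w]
    by (simp add: strategy_mean_def)
qed

lemma strategy_mean_range:
  assumes q: "single_edge_strategy D q" and w: "bounded_reward D w"
    and ab: "\<And>k u. k \<in> {1..D} \<Longrightarrow> u \<in> space (unif_cube D) \<Longrightarrow> a \<le> w k u \<and> w k u \<le> b"
  shows "a \<le> strategy_mean D q w" "strategy_mean D q w \<le> b"
proof -
  interpret prob_space "unif_cube D" by (rule prob_space_unif_cube)
  show "strategy_mean D q w \<le> b" unfolding strategy_mean_def
    using strategy_mean_bounds(2)[OF q, where w = w] ab
    by (intro integral_le_const strategy_mean_integrable[OF q w] AE_I2) blast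
  show "a \<le> strategy_mean D q w" unfolding strategy_mean_def
    using strategy_mean_bounds(1)[OF q, where w = w] ab
    by (intro integral_ge_const strategy_mean_integrable[OF q w] AE_I2) blast
qed

lemma strategy_mean_linear_sum:
  assumes q: "single_edge_strategy D q" and w0: "bounded_reward D w"
    and v: "\<And>m. m < (N::nat) \<Longrightarrow> bounded_reward D (v m)"
  shows "strategy_mean D q (\<lambda>k u. w k u - (\<Sum>m<N. a m * v m k u))
           = strategy_mean D q w - (\<Sum>m<N. a m * strategy_mean D q (v m))"
proof -
  have eq: "(\<Sum>k\<in>{1..D}. q k u * (w k u - (\<Sum>m<N. a m * v m k u)))
      = (\<Sum>k\<in>{1..D}. q k u * w k u) - (\<Sum>m<N. a m * (\<Sum>k\<in>{1..D}. q k u * v m k u))" for u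
    by (simp add: right_diff_distrib sum_subtractf sum_distrib_left
        sum.swap[of _ "{..<N}"] mult.left_commute)
  have int: "integrable (unif_cube D) (\<lambda>u. a m * (\<Sum>k\<in>{1..D}. q k u * v m k u))" if "m < N" for m
    using strategy_mean_integrable[OF q v[OF that]] by simp
  have "(\<integral>u. (\<Sum>m<N. a m * (\<Sum>k\<in>{1..D}. q k u * v m k u)) \<partial>unif_cube D)
      = (\<Sum>m<N. a m * strategy_mean D q (v m))"
    unfolding strategy_mean_def using int
    by (subst Bochner_Integration.integral_sum) auto
  then show ?thesis
    unfolding strategy_mean_def eq using int strategy_mean_integrable[OF q w0]
    by (subst Bochner_Integration.integral_diff) auto
qed

section \<open>Integration against the law of the chosen weight\<close>

lemma measurable_chosen_weight:
  "(\<lambda>(u, k). u k) \<in> measurable (unif_cube D \<Otimes>\<^sub>M count_space {1..D}) unif01"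
  unfolding case_prod_beta
  by (rule measurable_compose_countable'[where f = "\<lambda>k z. fst z k" and g = snd and I = "{1..D}"])
     (auto intro: measurable_compose[OF measurable_fst measurable_unif_cube_coord(1)])

lemma nn_integral_strategy_law:
  assumes q: "single_edge_strategy D q" and f: "f \<in> borel_measurable unif01"
  shows "(\<integral>\<^sup>+x. f x \<partial>strategy_law D q)
           = (\<integral>\<^sup>+u. (\<Sum>k\<in>{1..D}. ennreal (q k u) * f (u k)) \<partial>unif_cube D)"
proof -
  have c: "sigma_finite_measure (count_space {1..D})"
    by (rule sigma_finite_measure_count_space_finite) simp
  have dens: "(\<lambda>(u, k). ennreal (q k u)) \<in> borel_measurable (unif_cube D \<Otimes>\<^sub>M count_space {1..D})"
    unfolding case_prod_beta
    by (rule measurable_compose_countable'[where f = "\<lambda>k z. ennreal (q k (fst z))" and g = snd and I = "{1..D}"])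
       (use strategyD(1)[OF q] in
         \<open>auto intro!: measurable_compose[OF measurable_compose[OF measurable_fst] measurable_ennreal]\<close>)
  note m = measurable_compose[OF measurable_chosen_weight f]
  have "(\<integral>\<^sup>+x. f x \<partial>strategy_law D q)
      = (\<integral>\<^sup>+z. ennreal (q (snd z) (fst z)) * f (fst z (snd z)) \<partial>(unif_cube D \<Otimes>\<^sub>M count_space {1..D}))"
    unfolding strategy_law_def
    using f dens m measurable_chosen_weight[of D]
    by (subst nn_integral_distr) (auto simp: case_prod_beta nn_integral_density)
  also have "\<dots> = (\<integral>\<^sup>+u. \<integral>\<^sup>+k. ennreal (q k u) * f (u k) \<partial>count_space {1..D} \<partial>unif_cube D)"
    using borel_measurable_times_ennreal[OF dens m]
    by (subst sigma_finite_measure.nn_integral_fst[OF c, symmetric]) (auto simp: case_prod_beta)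
  finally show ?thesis by (simp add: nn_integral_count_space_finite)
qed

lemma sets_strategy_law [simp]: "sets (strategy_law D q) = sets unif01"
  by (simp add: strategy_law_def)

lemma space_strategy_law [simp]: "space (strategy_law D q) = {0..1}"
  by (simp add: strategy_law_def)

text \<open>General enough for indicators, which give masses of sets, and for the identity, whose
  integral is the mean of the law.\<close>

lemma nn_integral_strategy_law_bounded:
  assumes q: "single_edge_strategy D q" and f: "f \<in> borel_measurable unif01"
    and b: "\<And>x. x \<in> {0..1} \<Longrightarrow> 0 \<le> f x \<and> f x \<le> (B::real)"
  shows "(\<integral>\<^sup>+x. f x \<partial>strategy_law D q) = ennreal (strategy_mean D q (\<lambda>k u. f (u k)))"
proof -
  have w: "bounded_reward D (\<lambda>k u. f (u k))"
    unfolding bounded_reward_def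
  proof (intro conjI ballI exI[of _ B])
    fix k u assume k: "k \<in> {1..D}"
    show "(\<lambda>u. f (u k)) \<in> borel_measurable (unif_cube D)"
      using measurable_compose[OF measurable_unif_cube_coord(1)[OF k] f] .
    assume "u \<in> space (unif_cube D)"
    with b[OF unif_cube_coord_range[OF this k]] show "\<bar>f (u k)\<bar> \<le> B" by auto
  qed
  have nn: "0 \<le> q k u * f (u k)" if "k \<in> {1..D}" "u \<in> space (unif_cube D)" for k u
    using b[OF unif_cube_coord_range[OF that(2,1)]] strategyD(2)[OF q that] by auto
  have "(\<integral>\<^sup>+x. f x \<partial>strategy_law D q)
      = (\<integral>\<^sup>+u. ennreal (\<Sum>k\<in>{1..D}. q k u * f (u k)) \<partial>unif_cube D)"
    unfolding nn_integral_strategy_law[OF q measurable_compose[OF f measurable_ennreal]]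
  proof (intro nn_integral_cong)
    fix u assume u: "u \<in> space (unif_cube D)"
    have "(\<Sum>k\<in>{1..D}. ennreal (q k u) * ennreal (f (u k))) = (\<Sum>k\<in>{1..D}. ennreal (q k u * f (u k)))"
      using b[OF unif_cube_coord_range[OF u]] strategyD(2)[OF q _ u]
      by (intro sum.cong) (auto simp: ennreal_mult)
    also have "\<dots> = ennreal (\<Sum>k\<in>{1..D}. q k u * f (u k))"
      using nn u by (intro sum_ennreal) auto
    finally show "(\<Sum>k\<in>{1..D}. ennreal (q k u) * ennreal (f (u k)))
        = ennreal (\<Sum>k\<in>{1..D}. q k u * f (u k))" .
  qed
  also have "\<dots> = ennreal (strategy_mean D q (\<lambda>k u. f (u k)))"
    unfolding strategy_mean_def
    by (rule nn_integral_eq_integral[OF strategy_mean_integrable[OF q w]])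
       (intro AE_I2 sum_nonneg nn)
  finally show ?thesis .
qed

lemma bounded_reward_indicator:
  assumes "A \<in> sets borel"
  shows "bounded_reward D (\<lambda>k u. indicator A (u k))"
  unfolding bounded_reward_def
proof (intro conjI ballI exI[of _ 1])
  fix k assume "k \<in> {1..D}"
  then show "(\<lambda>u. indicator A (u k)) \<in> borel_measurable (unif_cube D)"
    by (rule measurable_compose[OF measurable_unif_cube_coord(2) borel_measurable_indicator[OF assms]])
qed (auto split: split_indicator)

text \<open>The intersection with \<open>{0..1}\<close> admits every Borel set of the line, so
  half-lines and cells can be used without trimming them first.\<close>

lemma measure_strategy_law:
  assumes q: "single_edge_strategy D q" and A: "A \<in> sets borel"
  shows "measure (strategy_law D q) (A \<inter> {0..1}) = strategy_mean D q (\<lambda>k u. indicator A (u k))"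
proof -
  have "emeasure (strategy_law D q) (A \<inter> {0..1}) = (\<integral>\<^sup>+x. indicator (A \<inter> {0..1}) x \<partial>strategy_law D q)"
    using A by (intro nn_integral_indicator[symmetric]) simp
  also have "\<dots> = (\<integral>\<^sup>+x. ennreal (indicator A x) \<partial>strategy_law D q)"
    by (intro nn_integral_cong) (auto split: split_indicator)
  also have "\<dots> = ennreal (strategy_mean D q (\<lambda>k u. indicator A (u k)))"
    by (rule nn_integral_strategy_law_bounded[OF q, of _ 1])
       (use A measurable_compose[OF measurable_unif01_ident borel_measurable_indicator] in \<open>auto split: split_indicator\<close>)
  finally show ?thesis
    using strategy_mean_range(1)[OF q bounded_reward_indicator[OF A], of 0 1]
    by (simp add: measure_def)
qed

lemma prob_space_strategy_law:
  assumes q: "single_edge_strategy D q"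
  shows "prob_space (strategy_law D q)"
proof
  interpret prob_space "unif_cube D" by (rule prob_space_unif_cube)
  have "strategy_mean D q (\<lambda>k u. 1) = (\<integral>u. 1 \<partial>unif_cube D)"
    unfolding strategy_mean_def
    by (intro Bochner_Integration.integral_cong) (use strategy_sum[OF q] in auto)
  then show "emeasure (strategy_law D q) (space (strategy_law D q)) = 1"
    using nn_integral_strategy_law_bounded[OF q, of "\<lambda>_. 1" 1] prob_space by simp
qed

text \<open>As \<open>q k u \<le> 1\<close>, the law of the chosen weight is dominated by the sum of
  the \<open>D\<close> coordinate laws, all uniform.\<close>

lemma measure_strategy_law_le:
  assumes q: "single_edge_strategy D q" and A: "A \<in> sets unif01"
  shows "measure (strategy_law D q) A \<le> D * measure lborel A"
proof -
  interpret C: prob_space "unif_cube D" by (rule prob_space_unif_cube)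
  interpret I: prob_space unif01 by (rule prob_space_unif01)
  have A': "A \<in> sets borel" "A \<inter> {0..1} = A" using A by (auto simp: sets_unif01_iff)
  have int: "integrable (unif_cube D) (\<lambda>u. indicator A (u k) :: real)" if k: "k \<in> {1..D}" for k
    using measurable_compose[OF measurable_unif_cube_coord(2)[OF k] borel_measurable_indicator[OF A'(1)]]
    by (intro C.integrable_const_bound[where B = 1]) (auto split: split_indicator)
  have "measure (strategy_law D q) A = strategy_mean D q (\<lambda>k u. indicator A (u k))"
    using measure_strategy_law[OF q A'(1)] A'(2) by simp
  also have "\<dots> \<le> (\<integral>u. (\<Sum>k\<in>{1..D}. indicator A (u k)) \<partial>unif_cube D)"
    unfolding strategy_mean_def
    using strategyD(2,3)[OF q]
    by (intro integral_mono strategy_mean_integrable[OF q bounded_reward_indicator[OF A'(1)]]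
        Bochner_Integration.integrable_sum int sum_mono) (auto split: split_indicator)
  also have "\<dots> = (\<Sum>k\<in>{1..D}. \<integral>u. indicator A (u k) \<partial>unif_cube D)"
    by (intro Bochner_Integration.integral_sum int)
  also have "\<dots> = (\<Sum>k\<in>{1..D}. measure lborel A)"
  proof (rule sum.cong[OF refl])
    fix k assume k: "k \<in> {1..D}"
    have "(\<integral>u. (indicator A (u k)::real) \<partial>unif_cube D)
        = (\<integral>x. indicator A x \<partial>distr (unif_cube D) unif01 (\<lambda>u. u k))"
      using A measurable_unif_cube_coord(1)[OF k]
      by (subst integral_distr) (auto)
    also have "\<dots> = measure unif01 A"
      unfolding distr_unif_cube_coord[OF k] using A sets.sets_into_space[OF A]
      by (simp add: Int_absorb2)
    also have "\<dots> = measure lborel A" using emeasure_unif01[OF A] by (simp add: measure_def)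
    finally show "(\<integral>u. (indicator A (u k)::real) \<partial>unif_cube D) = measure lborel A" .
  qed
  finally show ?thesis by simp
qed

lemma strategy_law_cdf_Lipschitz:
  assumes q: "single_edge_strategy D q" and "x \<le> y"
  shows "measure (strategy_law D q) ({..x} \<inter> {0..1}) \<le> measure (strategy_law D q) ({..y} \<inter> {0..1})"
    and "measure (strategy_law D q) ({..y} \<inter> {0..1})
           \<le> measure (strategy_law D q) ({..x} \<inter> {0..1}) + D * (y - x)"
proof -
  interpret prob_space "strategy_law D q" by (rule prob_space_strategy_law[OF q])
  show "prob ({..x} \<inter> {0..1}) \<le> prob ({..y} \<inter> {0..1})"
    using \<open>x \<le> y\<close> by (intro finite_measure_mono) (auto simp: sets_unif01_iff)
  have "prob ({..y} \<inter> {0..1}) \<le> prob (({..x} \<inter> {0..1}) \<union> ({x<..y} \<inter> {0..1}))"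
    by (intro finite_measure_mono) (auto simp: sets_unif01_iff)
  also have "\<dots> \<le> prob ({..x} \<inter> {0..1}) + prob ({x<..y} \<inter> {0..1})"
    by (intro measure_Un_le) (auto simp: sets_unif01_iff)
  also have "prob ({x<..y} \<inter> {0..1}) \<le> D * measure lborel ({x<..y} \<inter> {0..1})"
    by (intro measure_strategy_law_le[OF q]) simp
  also have "measure lborel ({x<..y} \<inter> {0..1}) \<le> measure lborel {x<..y}"
    by (intro measure_mono_fmeasurable) (use \<open>x \<le> y\<close> in \<open>auto simp: fmeasurable_def\<close>)
  finally show "prob ({..y} \<inter> {0..1}) \<le> prob ({..x} \<inter> {0..1}) + D * (y - x)"
    using \<open>x \<le> y\<close> by (simp add: mult_left_mono)
qed

text \<open>A countable family, so that a finite initial part can be tested. It sees only the chosen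
  weight \<open>u k\<close>, so its averages along a path are masses under the empirical
  measure.\<close>

definition half_line_test :: "nat \<Rightarrow> nat \<Rightarrow> (nat \<Rightarrow> real) \<Rightarrow> real" where
  "half_line_test m k u = indicator {..real_of_rat (nat_to_rat_surj m)} (u k)"

lemma bounded_reward_half_line_test: "bounded_reward D (half_line_test m)"
  unfolding half_line_test_def[abs_def] by (intro bounded_reward_indicator) auto

text \<open>The tests give the distribution functions at rational points; the Lipschitz bound
  carries the agreement to every real point.\<close>

lemma strategy_law_eqI:
  assumes q: "single_edge_strategy D q" and q': "single_edge_strategy D q'"
    and eq: "\<And>m. strategy_mean D q (half_line_test m) = strategy_mean D q' (half_line_test m)"
  shows "strategy_law D q = strategy_law D q'"
proof -
  let ?F = "\<lambda>q x. measure (strategy_law D q) ({..x} \<inter> {0..1})"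
  have rat: "?F q r = ?F q' r" if "r \<in> \<rat>" for r :: real
  proof -
    from that obtain x where "r = real_of_rat x" by (rule Rats_cases)
    moreover obtain m where "x = nat_to_rat_surj m" using surjD[OF surj_nat_to_rat_surj] by blast
    ultimately have "r = real_of_rat (nat_to_rat_surj m)" by simp
    then show ?thesis
      using eq[of m] measure_strategy_law[OF q, of "{..r}"] measure_strategy_law[OF q', of "{..r}"]
      by (simp add: half_line_test_def[abs_def])
  qed
  have le: "?F p x \<le> ?F p' x" if p: "single_edge_strategy D p" and p': "single_edge_strategy D p'"
    and e: "\<And>r. r \<in> \<rat> \<Longrightarrow> ?F p r = ?F p' r" for p p' x
  proof (rule field_le_epsilon)
    fix e :: real assume "e > 0"
    obtain r where r: "r \<in> \<rat>" "x < r" "r < x + e / (D + 1)"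
      using Rats_dense_in_real[of x "x + e / (D + 1)"] \<open>e > 0\<close> by auto
    have "?F p x \<le> ?F p r" using strategy_law_cdf_Lipschitz(1)[OF p] r by simp
    also have "\<dots> = ?F p' r" by (rule e[OF r(1)])
    also have "\<dots> \<le> ?F p' x + D * (r - x)" using strategy_law_cdf_Lipschitz(2)[OF p'] r by simp
    also have "D * (r - x) \<le> (D + 1) * (e / (D + 1))"
      using r \<open>e > 0\<close> by (intro mult_mono) auto
    finally show "?F p x \<le> ?F p' x + e" by simp
  qed
  \<comment> \<open>\<open>cdf_unique\<close> concerns laws on the whole line, hence the detour
    through images under the inclusion of \<open>[0,1]\<close>.\<close>
  have cdf: "cdf (distr (strategy_law D p) borel (\<lambda>x. x)) x = ?F p x" for p x
    unfolding cdf_def by (subst measure_distr)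
      (auto simp: measurable_cong_sets[OF sets_strategy_law refl] vimage_def Int_commute)
  have real: "real_distribution (distr (strategy_law D p) borel (\<lambda>x. x))" if "single_edge_strategy D p" for p
    unfolding real_distribution_def real_distribution_axioms_def
    using prob_space.prob_space_distr[OF prob_space_strategy_law[OF that], of "\<lambda>x. x" borel]
    by (auto simp: measurable_cong_sets[OF sets_strategy_law refl])
  have "distr (strategy_law D q) borel (\<lambda>x. x) = distr (strategy_law D q') borel (\<lambda>x. x)"
    using le[OF q q' rat] le[OF q' q rat[symmetric]]
    by (intro cdf_unique real q q' ext) (simp add: cdf antisym)
  then have *: "emeasure (distr (strategy_law D q) borel (\<lambda>x. x)) A
      = emeasure (distr (strategy_law D q') borel (\<lambda>x. x)) A" for A by simp
  show ?thesis
  proof (rule measure_eqI)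
    fix A assume "A \<in> sets (strategy_law D q)"
    then have A: "A \<in> sets borel" "A \<subseteq> {0..1}" by (auto simp: sets_unif01_iff)
    have **: "emeasure (distr (strategy_law D p) borel (\<lambda>x. x)) A = emeasure (strategy_law D p) A" for p
      using A by (subst emeasure_distr)
        (auto simp: measurable_cong_sets[OF sets_strategy_law refl] vimage_def Int_absorb2)
    show "emeasure (strategy_law D q) A = emeasure (strategy_law D q') A"
      using *[of A] unfolding ** .
  qed simp
qed

subsection \<open>Extreme laws and their strategies\<close>

text \<open>By Fubini in coordinate \<open>a\<close>, since a single point has no mass. It later
  removes the factor \<open>\<bar>u a - u b\<bar>\<close> from a vanishing integrand.\<close>

lemma AE_unif_cube_coord_neq:
  assumes "a \<in> {1..D}" "b \<in> {1..D}" "a \<noteq> b"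
  shows "AE u in unif_cube D. u a \<noteq> u b"
proof -
  interpret prob_space unif01 by (rule prob_space_unif01)
  interpret product_sigma_finite "\<lambda>_::nat. unif01"
    by standard
  define I where "I = {1..D} - {a}"
  have I: "insert a I = {1..D}" "a \<notin> I" "finite I" "b \<in> I" using assms by (auto simp: I_def)
  have m [measurable]: "{u \<in> space (unif_cube D). u a = u b} \<in> sets (unif_cube D)"
    using measurable_unif_cube_coord(2)[OF assms(1)] measurable_unif_cube_coord(2)[OF assms(2)]
    by measurable
  let ?N = "{u \<in> space (unif_cube D). u a = u b}"
  have "emeasure (unif_cube D) ?N = (\<integral>\<^sup>+u. indicator ?N u \<partial>Pi\<^sub>M (insert a I) (\<lambda>_. unif01))"
    unfolding I by (rule nn_integral_indicator[symmetric, OF m])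
  also have "\<dots> = (\<integral>\<^sup>+x. (\<integral>\<^sup>+y. indicator ?N (x(a := y)) \<partial>unif01) \<partial>Pi\<^sub>M I (\<lambda>_. unif01))"
    by (rule product_nn_integral_insert[OF I(3,2)]) (unfold I(1), rule borel_measurable_indicator[OF m])
  also have "\<dots> \<le> (\<integral>\<^sup>+x. 0 \<partial>Pi\<^sub>M I (\<lambda>_. unif01))"
  proof (intro nn_integral_mono)
    fix x assume "x \<in> space (Pi\<^sub>M I (\<lambda>_. unif01))"
    then have "x b \<in> {0..1}" using I by (auto simp: space_PiM PiE_iff)
    then have s: "{x b} \<in> sets unif01" by (auto simp: sets_unif01_iff)
    have "(\<integral>\<^sup>+y. indicator ?N (x(a := y)) \<partial>unif01) \<le> (\<integral>\<^sup>+y. indicator {x b} y \<partial>unif01)"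
      using assms by (intro nn_integral_mono) (auto split: split_indicator)
    also have "\<dots> = 0" using s emeasure_unif01[OF s] by simp
    finally show "(\<integral>\<^sup>+y. indicator ?N (x(a := y)) \<partial>unif01) \<le> 0" .
  qed
  finally have "emeasure (unif_cube D) ?N = 0" by simp
  then show ?thesis by (intro AE_I[OF _ _ m]) auto
qed

text \<open>If \<open>q a * p b\<close> did not vanish, moving mass \<open>q a * p b / 2\<close> between the choices \<open>a\<close> and
  \<open>b\<close> of the average of \<open>p\<close> and \<open>q\<close>, towards the larger coordinate and towards the smaller one,
  would write the law as the midpoint of two laws with different means.\<close>
lemma extreme_strategy_law_unique:
  assumes p: "single_edge_strategy D p"
    and ext: "extreme_measure_of (strategy_law D p) {strategy_law D q | q. single_edge_strategy D q}"
    and q: "single_edge_strategy D q" and eq: "strategy_law D q = strategy_law D p"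
    and ab: "a \<in> {1..D}" "b \<in> {1..D}" "a \<noteq> b"
  shows "AE u in unif_cube D. q a u * p b u = 0"
proof -
  interpret prob_space "unif_cube D" by (rule prob_space_unif_cube)
  define h where "h u = sgn (u a - u b) * (q a u * p b u) / 2" for u
  define r where "r s i u = (1 - 1/2) * p i u + 1/2 * q i u
      + s * (if i = a then h u else if i = b then - h u else 0)" for s :: real and i u
  have mean: "single_edge_strategy D (\<lambda>k u. (1 - 1/2) * p k u + 1/2 * q k u)"
    by (rule strategy_convex_comb[OF p q]) auto
  have hm: "h \<in> borel_measurable (unif_cube D)"
    using measurable_unif_cube_coord(2)[OF ab(1)] measurable_unif_cube_coord(2)[OF ab(2)]
      strategyD(1)[OF q ab(1)] strategyD(1)[OF p ab(2)]
    unfolding h_def by measurable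
  \<comment> \<open>The average of \<open>p\<close> and \<open>q\<close> has at least
    \<open>q a u / 2\<close> at \<open>a\<close> and at least \<open>p b u / 2\<close> at
    \<open>b\<close>, so a transfer bounded by both keeps all entries nonnegative in either
    direction.\<close>
  have hb: "\<bar>h u\<bar> \<le> q a u / 2" "\<bar>h u\<bar> \<le> p b u / 2" "0 \<le> p a u" "0 \<le> q b u" if u: "u \<in> space (unif_cube D)" for u
  proof -
    note b = strategyD(2,3)[OF q ab(1) u] strategyD(2,3)[OF p ab(2) u]
    have "\<bar>h u\<bar> \<le> q a u * p b u / 2"
      using b by (auto simp: h_def sgn_real_def abs_mult)
    moreover have "q a u * p b u \<le> q a u" "q a u * p b u \<le> p b u"
      using b by (auto intro: mult_left_le mult_left_le_one_le)
    ultimately show "\<bar>h u\<bar> \<le> q a u / 2" "\<bar>h u\<bar> \<le> p b u / 2" by auto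
  qed (use that strategyD(2)[OF q ab(2)] strategyD(2)[OF p ab(1)] in auto)
  have r: "single_edge_strategy D (r s)" if s: "s = 1 \<or> s = -1" for s
  proof (rule strategyI)
    fix k assume "k \<in> {1..D}"
    then show "r s k \<in> borel_measurable (unif_cube D)"
      using strategyD(1)[OF p] strategyD(1)[OF q] hm unfolding r_def[abs_def]
      by (cases "k = a"; cases "k = b") (auto)
  next
    fix k u assume k: "k \<in> {1..D}" and u: "u \<in> space (unif_cube D)"
    show "0 \<le> r s k u"
      using hb[OF u] strategyD(2)[OF p k u] strategyD(2)[OF q k u] s unfolding r_def by auto
  next
    fix u assume u: "u \<in> space (unif_cube D)"
    have "(\<Sum>k\<in>{1..D}. (if k = a then h u else if k = b then - h u else 0))
        = (\<Sum>k\<in>{1..D}. (if k = a then h u else 0) + (if k = b then - h u else 0))"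
      using ab by (intro sum.cong) auto
    also have "\<dots> = 0" using ab by (subst sum.distrib) simp
    finally show "(\<Sum>k\<in>{1..D}. r s k u) = 1"
      using strategy_sum[OF mean u] unfolding r_def by (simp add: sum.distrib sum_distrib_left[symmetric])
  qed
  have r1: "single_edge_strategy D (r 1)" and r2: "single_edge_strategy D (r (-1))" using r by auto
  \<comment> \<open>The two transfers cancel, and the average of \<open>p\<close> and
    \<open>q\<close> has the law of \<open>p\<close> because both do. Extremality therefore forces
    the two perturbed laws to coincide.\<close>
  have mid: "(\<lambda>k u. (1 - 1/2) * r 1 k u + 1/2 * r (-1) k u) = (\<lambda>k u. (1 - 1/2) * p k u + 1/2 * q k u)"
    unfolding r_def by (auto simp: fun_eq_iff field_simps)
  have "measure (strategy_law D p) A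
      = (1 - 1/2) * measure (strategy_law D (r 1)) A + 1/2 * measure (strategy_law D (r (-1))) A"
    if "A \<in> sets (strategy_law D p)" for A
  proof -
    from that have A: "A \<in> sets borel" "A \<inter> {0..1} = A" by (auto simp: sets_unif01_iff)
    note ms = measure_strategy_law[OF _ A(1), unfolded A(2)]
    note w = bounded_reward_indicator[OF A(1)]
    show ?thesis
      using strategy_mean_convex_comb[OF r1 r2 w, of "1/2"] strategy_mean_convex_comb[OF p q w, of "1/2"]
        arg_cong[OF eq, of "\<lambda>N. measure N A"]
      unfolding mid by (simp add: ms[OF p] ms[OF q] ms[OF r1] ms[OF r2])
  qed
  moreover have "(0::real) < 1/2" "(1/2::real) < 1" by auto
  ultimately have laws: "strategy_law D (r 1) = strategy_law D (r (-1))"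
    using ext r1 r2 unfolding extreme_measure_of_def by blast
  have w: "bounded_reward D (\<lambda>k u. u k)"
    unfolding bounded_reward_def
    using unif_cube_coord_range[of _ D] measurable_unif_cube_coord(2)[of _ D]
    by (intro conjI ballI exI[of _ 1]) fastforce+
  have law_mean: "(\<integral>\<^sup>+x. ennreal x \<partial>strategy_law D (r s)) = ennreal (strategy_mean D (r s) (\<lambda>k u. u k))"
    if "s = 1 \<or> s = -1" for s
    by (rule nn_integral_strategy_law_bounded[OF r[OF that], of "\<lambda>x. x" 1]) auto
  have "0 \<le> strategy_mean D (r s) (\<lambda>k u. u k)" if "s = 1 \<or> s = -1" for s
    using unif_cube_coord_range by (intro strategy_mean_range(1)[OF r[OF that] w, of 0 1]) auto
  then have means: "strategy_mean D (r 1) (\<lambda>k u. u k) = strategy_mean D (r (-1)) (\<lambda>k u. u k)"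
    using law_mean[of 1] law_mean[of "-1"] laws by simp
  \<comment> \<open>The sign in \<open>h\<close> turns \<open>u a - u b\<close> into its absolute
    value. The integrand is thus nonnegative, and equal means make it vanish almost
    everywhere.\<close>
  have diff: "(\<Sum>k\<in>{1..D}. r 1 k u * u k) - (\<Sum>k\<in>{1..D}. r (-1) k u * u k)
      = q a u * p b u * \<bar>u a - u b\<bar>" for u
  proof -
    have "(\<Sum>k\<in>{1..D}. r 1 k u * u k) - (\<Sum>k\<in>{1..D}. r (-1) k u * u k)
        = (\<Sum>k\<in>{1..D}. (if k = a then 2 * h u * u a else 0) + (if k = b then - 2 * h u * u b else 0))"
      unfolding sum_subtractf[symmetric] using ab
      by (intro sum.cong) (auto simp: r_def algebra_simps)
    also have "\<dots> = 2 * h u * (u a - u b)" using ab by (subst sum.distrib) (simp add: algebra_simps)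
    also have "\<dots> = q a u * p b u * (sgn (u a - u b) * (u a - u b))" by (simp add: h_def)
    finally show ?thesis by (simp add: abs_sgn mult.commute)
  qed
  note int = strategy_mean_integrable[OF r1 w] strategy_mean_integrable[OF r2 w]
  have "(\<integral>u. q a u * p b u * \<bar>u a - u b\<bar> \<partial>unif_cube D) = 0"
    using means int by (simp add: strategy_mean_def diff[symmetric])
  moreover have "integrable (unif_cube D) (\<lambda>u. q a u * p b u * \<bar>u a - u b\<bar>)"
    using Bochner_Integration.integrable_diff[OF int] by (simp only: diff)
  moreover have "AE u in unif_cube D. 0 \<le> q a u * p b u * \<bar>u a - u b\<bar>"
    using strategyD(2)[OF q ab(1)] strategyD(2)[OF p ab(2)] by (intro AE_I2) auto
  ultimately have "AE u in unif_cube D. q a u * p b u * \<bar>u a - u b\<bar> = 0"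
    using integral_nonneg_eq_0_iff_AE by blast
  with AE_unif_cube_coord_neq[OF ab] show ?thesis by eventually_elim auto
qed

text \<open>A strategy serving as its own reward has as mean its squared \<open>L\<^sup>2\<close>
  norm.\<close>

lemma bounded_reward_strategy: "single_edge_strategy D q \<Longrightarrow> bounded_reward D q"
  using strategyD[of D q] unfolding bounded_reward_def
  by (intro conjI ballI exI[of _ 1]) (auto)

text \<open>The sequence is chosen with asymptotically minimal \<open>L\<^sup>2\<close> norm in the sets \<open>K N\<close>; by the
  parallelogram law it is Cauchy in \<open>L\<^sup>2\<close>, so no weak compactness is needed.\<close>
lemma nested_convex_strategies_limit:
  assumes strat: "\<And>N q. q \<in> K N \<Longrightarrow> single_edge_strategy D q"
    and ne: "\<And>N. K N \<noteq> {}" and dec: "\<And>N. K (Suc N) \<subseteq> K N"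
    and conv: "\<And>N q r. q \<in> K N \<Longrightarrow> r \<in> K N \<Longrightarrow> (\<lambda>k u. (1 - 1/2) * q k u + 1/2 * r k u) \<in> K N"
  shows "\<exists>q r. single_edge_strategy D r \<and> (\<forall>j. q j \<in> K j) \<and>
           (AE u in unif_cube D. \<forall>k\<in>{1..D}. (\<lambda>j. q j k u) \<longlonglongrightarrow> r k u)"
proof -
  interpret prob_space "unif_cube D" by (rule prob_space_unif_cube)
  define S where "S q = strategy_mean D q q" for q
  define s where "s N = (INF q\<in>K N. S q)" for N
  have decr: "K N \<subseteq> K M" if "M \<le> N" for M N
    using lift_Suc_antimono_le[of K, OF dec that] .
  have S01: "0 \<le> S q" "S q \<le> 1" if "single_edge_strategy D q" for q
    using strategy_mean_range[OF that bounded_reward_strategy[OF that], of 0 1] strategyD[OF that]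
    unfolding S_def by blast+
  have bdd: "bdd_below (S ` K N)" for N
    using S01(1)[OF strat] by (intro bdd_belowI2[of _ 0])
  have s_le: "s N \<le> S q" if "q \<in> K N" for q N
    unfolding s_def by (rule cINF_lower[OF bdd that])
  have s1: "s N \<le> 1" for N
    using ne[of N] s_le[of _ N] S01(2)[OF strat] by (metis all_not_in_conv order_trans)
  have s_mono: "s M \<le> s N" if "M \<le> N" for M N
    unfolding s_def using decr[OF that] ne bdd by (intro cINF_superset_mono) auto
  define L where "L = (SUP N. s N)"
  have bddL: "bdd_above (range s)" using s1 by (intro bdd_aboveI2[of _ _ 1])
  have s_L: "s N \<le> L" for N unfolding L_def by (rule cSUP_upper[OF UNIV_I bddL])
  \<comment> \<open>Errors of order \<open>(1/4)^j\<close> stay summable after multiplication by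
    \<open>2^j\<close>, as needed below. The infimum may come close to \<open>L\<close> only at a
    late \<open>N\<close>; requiring \<open>j \<le> N\<close> still places the strategy in
    \<open>K j\<close>.\<close>
  have "\<exists>N q. j \<le> N \<and> L - (1/4)^j \<le> s N \<and> q \<in> K N \<and> S q \<le> L + (1/4)^j" for j
  proof -
    obtain N0 where "L - (1/4)^j < s N0"
      using less_cSUP_iff[OF _ bddL, of "L - (1/4)^j"] unfolding L_def by auto
    with s_mono[of N0 "max N0 j"] have N: "L - (1/4)^j \<le> s (max N0 j)" by simp
    have "Inf (S ` K (max N0 j)) < s (max N0 j) + (1/4)^j" unfolding s_def by simp
    then obtain q where "q \<in> K (max N0 j)" "S q < s (max N0 j) + (1/4)^j"
      using cInf_lessD[of "S ` K (max N0 j)"] ne by blast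
    with N s_L[of "max N0 j"] show ?thesis
      by (intro exI[of _ "max N0 j"] exI[of _ q]) auto
  qed
  then obtain n q where n: "\<And>j. j \<le> n j" "\<And>j. L - (1/4)^j \<le> s (n j)"
    and qn: "\<And>j. q j \<in> K (n j)" and Sq: "\<And>j. S (q j) \<le> L + (1/4)^j" by metis
  have q: "single_edge_strategy D (q j)" for j by (rule strat[OF qn])
  have qK: "q j \<in> K j" for j using qn decr[OF n(1)] by blast
  note qD = strategyD[OF q]
  define d where "d j u = (\<Sum>k\<in>{1..D}. (q (Suc j) k u - q j k u)\<^sup>2)" for j u
  have d_int: "integrable (unif_cube D) (d j)" and d_le: "(\<integral>u. d j u \<partial>unif_cube D) \<le> 8 * (1/4)^j" for j
  proof -
    let ?m = "\<lambda>k u. (1 - 1/2) * q j k u + 1/2 * q (Suc j) k u"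
    \<comment> \<open>The midpoint lies in the larger of the two sets, whose infimum is at least
      \<open>L - (1/4)^j\<close>. This bounds from below the term subtracted in the parallelogram
      identity.\<close>
    have m: "?m \<in> K (min (n j) (n (Suc j)))"
      using qn decr[of "min (n j) (n (Suc j))" "n j"] decr[of "min (n j) (n (Suc j))" "n (Suc j)"]
      by (intro conv) auto
    have "(1/4::real)^Suc j \<le> (1/4)^j" by simp
    then have "L - (1/4)^j \<le> s (n (Suc j))" using n(2)[of "Suc j"] by linarith
    then have "L - (1/4)^j \<le> s (min (n j) (n (Suc j)))"
      using n(2)[of j] by (auto simp: min_def)
    also have "\<dots> \<le> S ?m" by (rule s_le[OF m])
    finally have Sm: "L - (1/4)^j \<le> S ?m" .
    have pt: "(x - y)\<^sup>2 = 2 * (y * y) + 2 * (x * x) - 4 * (((1 - 1/2) * y + 1/2 * x) * ((1 - 1/2) * y + 1/2 * x))"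
      for x y :: real by (simp add: power2_eq_square field_simps)
    have d: "d j = (\<lambda>u. 2 * (\<Sum>k\<in>{1..D}. q j k u * q j k u) + 2 * (\<Sum>k\<in>{1..D}. q (Suc j) k u * q (Suc j) k u)
        - 4 * (\<Sum>k\<in>{1..D}. ?m k u * ?m k u))"
      unfolding d_def pt by (simp only: sum_distrib_left sum.distrib sum_subtractf)
    note int = strategy_mean_integrable[OF q bounded_reward_strategy[OF q]]
      strategy_mean_integrable[OF strat[OF m] bounded_reward_strategy[OF strat[OF m]]]
    have lin: "(\<integral>u. 2 * f u + 2 * g u - 4 * h u \<partial>unif_cube D)
        = 2 * (\<integral>u. f u \<partial>unif_cube D) + 2 * (\<integral>u. g u \<partial>unif_cube D) - 4 * (\<integral>u. h u \<partial>unif_cube D)"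
      if "integrable (unif_cube D) f" "integrable (unif_cube D) g" "integrable (unif_cube D) h"
      for f g h :: "(nat \<Rightarrow> real) \<Rightarrow> real" using that by simp
    show "integrable (unif_cube D) (d j)"
      unfolding d using int
      by (intro Bochner_Integration.integrable_diff Bochner_Integration.integrable_add
          integrable_mult_right)
    have "(\<integral>u. d j u \<partial>unif_cube D) = 2 * S (q j) + 2 * S (q (Suc j)) - 4 * S ?m"
      unfolding d S_def strategy_mean_def by (rule lin; rule int)
    then show "(\<integral>u. d j u \<partial>unif_cube D) \<le> 8 * (1/4)^j"
      using Sm Sq[of j] Sq[of "Suc j"] \<open>(1/4::real)^Suc j \<le> (1/4)^j\<close> by linarith
  qed
  \<comment> \<open>A summable majorant of the increments:
    \<open>\<bar>x\<bar> \<le> 2^j * x\<^sup>2 + (1/2)^j\<close> for every real \<open>x\<close>,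
    and the means of \<open>d j\<close> decay like \<open>(1/4)^j\<close>.\<close>
  define g where "g j u = 2^j * d j u + D * (1/2)^j" for j u
  have g0: "0 \<le> g j u" for j u unfolding g_def d_def by (intro add_nonneg_nonneg mult_nonneg_nonneg sum_nonneg) auto
  have g_int: "integrable (unif_cube D) (g j)" for j
    unfolding g_def[abs_def] using d_int by auto
  have g_le: "(\<integral>u. g j u \<partial>unif_cube D) \<le> (8 + D) * (1/2)^j" for j
  proof -
    have "(\<integral>u. g j u \<partial>unif_cube D) = 2^j * (\<integral>u. d j u \<partial>unif_cube D) + D * (1/2)^j"
      unfolding g_def using d_int by (simp add: prob_space)
    also have "\<dots> \<le> 2^j * (8 * (1/4)^j) + D * (1/2)^j"
      using d_le by (intro add_mono mult_left_mono) auto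
    also have "(2::real)^j * (8 * (1/4)^j) = 8 * (1/2)^j"
      by (simp add: power_mult_distrib[symmetric] flip: mult.assoc)
    finally show ?thesis by (simp add: algebra_simps)
  qed
  have "(\<integral>\<^sup>+u. (\<Sum>j. ennreal (g j u)) \<partial>unif_cube D) = (\<Sum>j. \<integral>\<^sup>+u. ennreal (g j u) \<partial>unif_cube D)"
    using borel_measurable_integrable[OF g_int] by (intro nn_integral_suminf) auto
  also have "\<dots> \<le> (\<Sum>j. ennreal ((8 + D) * (1/2)^j))"
    using g_le g0 by (intro suminf_le) (auto simp: nn_integral_eq_integral[OF g_int] ennreal_leI)
  also have "\<dots> < \<infinity>"
    by (subst suminf_ennreal2) (auto intro!: summable_mult summable_geometric)
  finally have "AE u in unif_cube D. (\<Sum>j. ennreal (g j u)) \<noteq> \<infinity>"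
    using borel_measurable_integrable[OF g_int]
    by (intro nn_integral_PInf_AE) (auto intro!: borel_measurable_suminf)
  then have ae: "AE u in unif_cube D. \<forall>k\<in>{1..D}. convergent (\<lambda>j. q j k u)"
  proof eventually_elim
    case (elim u)
    then have sm: "summable (\<lambda>j. g j u)"
      using g0 by (intro summable_suminf_not_top) auto
    show ?case
    proof
      fix k assume k: "k \<in> {1..D}"
      have "norm (q (Suc j) k u - q j k u) \<le> g j u" for j
      proof -
        let ?x = "q (Suc j) k u - q j k u"
        have "0 \<le> (2^j * \<bar>?x\<bar> - 1/2)\<^sup>2" by simp
        then have "2^j * \<bar>?x\<bar> \<le> 2^j * (2^j * ?x\<^sup>2) + 1"
          by (simp add: power2_eq_square algebra_simps abs_mult_self_eq)
        also have "\<dots> = 2^j * (2^j * ?x\<^sup>2 + (1/2)^j)"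
          by (simp add: distrib_left power_mult_distrib[symmetric])
        finally have "\<bar>?x\<bar> \<le> 2^j * ?x\<^sup>2 + (1/2)^j" by simp
        also have "?x\<^sup>2 \<le> d j u"
          unfolding d_def using k by (intro member_le_sum) auto
        also have "(1/2::real)^j \<le> D * (1/2)^j" using k by auto
        finally show ?thesis unfolding g_def by (simp add: mult_left_mono)
      qed
      then have "summable (\<lambda>j. q (Suc j) k u - q j k u)"
        by (intro summable_comparison_test'[OF sm])
      then have "convergent (\<lambda>n. (\<Sum>j<n. q (Suc j) k u - q j k u) + q 0 k u)"
        by (intro convergent_add convergent_const) (simp add: summable_iff_convergent)
      then show "convergent (\<lambda>j. q j k u)"
        by (simp add: sum_lessThan_telescope[of "\<lambda>j. q j k u"])
    qed
  qed
  define P where "P u \<longleftrightarrow> (\<forall>k\<in>{1..D}. convergent (\<lambda>j. q j k u))" for u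
  \<comment> \<open>Strategies satisfy their constraints at every point, not just almost everywhere;
    falling back on \<open>q 0\<close> where the sequence diverges preserves this.\<close>
  define r where "r k u = (if P u then lim (\<lambda>j. q j k u) else q 0 k u)" for k u
  have lim: "(\<lambda>j. q j k u) \<longlonglongrightarrow> r k u" if "P u" "k \<in> {1..D}" for u k
    using that unfolding r_def P_def by (simp add: convergent_LIMSEQ_iff)
  have "single_edge_strategy D r"
  proof (rule strategyI)
    fix k assume k: "k \<in> {1..D}"
    have "{u \<in> space (unif_cube D). P u} \<in> sets (unif_cube D)"
      unfolding P_def convergent_eq_Cauchy Cauchy_convergent_iff[symmetric]
      using qD(1) by (intro sets.sets_Collect_finite_All sets_Collect_Cauchy) auto
    then show "r k \<in> borel_measurable (unif_cube D)"
      unfolding r_def[abs_def] using qD(1)[OF k]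
      by (intro measurable_If borel_measurable_lim_metric) auto
  next
    fix k u assume k: "k \<in> {1..D}" and u: "u \<in> space (unif_cube D)"
    show "0 \<le> r k u"
    proof (cases "P u")
      case True
      show ?thesis by (rule LIMSEQ_le_const[OF lim[OF True k]]) (use qD(2)[OF k u] in auto)
    qed (use qD(2)[OF k u] in \<open>simp add: r_def\<close>)
  next
    fix u assume u: "u \<in> space (unif_cube D)"
    show "(\<Sum>k\<in>{1..D}. r k u) = 1"
    proof (cases "P u")
      case True
      have "(\<lambda>j. \<Sum>k\<in>{1..D}. q j k u) \<longlonglongrightarrow> (\<Sum>k\<in>{1..D}. r k u)"
        by (intro tendsto_sum lim True)
      then show ?thesis unfolding strategy_sum[OF q u] by (simp add: LIMSEQ_const_iff)
    qed (use strategy_sum[OF q u] in \<open>simp add: r_def\<close>)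
  qed
  moreover have "AE u in unif_cube D. \<forall>k\<in>{1..D}. (\<lambda>j. q j k u) \<longlonglongrightarrow> r k u"
    using ae by eventually_elim (auto intro!: lim simp: P_def)
  ultimately show ?thesis using qK by blast
qed

lemma strategy_mean_tendsto:
  assumes q: "\<And>j::nat. single_edge_strategy D (q j)" and r: "single_edge_strategy D r"
    and w: "bounded_reward D w"
    and lim: "AE u in unif_cube D. \<forall>k\<in>{1..D}. (\<lambda>j. q j k u) \<longlonglongrightarrow> r k u"
  shows "(\<lambda>j. strategy_mean D (q j) w) \<longlonglongrightarrow> strategy_mean D r w"
proof -
  interpret prob_space "unif_cube D" by (rule prob_space_unif_cube)
  from w obtain B where B: "\<And>k u. k \<in> {1..D} \<Longrightarrow> u \<in> space (unif_cube D) \<Longrightarrow> \<bar>w k u\<bar> \<le> B"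
    unfolding bounded_reward_def by blast
  show ?thesis unfolding strategy_mean_def
  proof (rule integral_dominated_convergence[where w = "\<lambda>_. B"])
    show "AE u in unif_cube D. (\<lambda>j. \<Sum>k\<in>{1..D}. q j k u * w k u) \<longlonglongrightarrow> (\<Sum>k\<in>{1..D}. r k u * w k u)"
      using lim by eventually_elim (intro tendsto_sum tendsto_mult tendsto_const, blast)
    show "AE u in unif_cube D. norm (\<Sum>k\<in>{1..D}. q j k u * w k u) \<le> B" for j
    proof (rule AE_I2)
      fix u assume u: "u \<in> space (unif_cube D)"
      have "- B \<le> w k u \<and> w k u \<le> B" if "k \<in> {1..D}" for k
        using B[OF that u] by auto
      from strategy_mean_bounds[OF q u, where w = w, OF this]
      show "norm (\<Sum>k\<in>{1..D}. q j k u * w k u) \<le> B" unfolding real_norm_def abs_le_iff by (simp add: minus_le_iff)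
    qed
  qed (use strategy_mean_measurable[OF q w] strategy_mean_measurable[OF r w] in \<open>auto\<close>)
qed

text \<open>For a 0-1 valued \<open>p\<close> this reward is 1 exactly at the indices that deviate
  from \<open>p\<close>, and its mean under \<open>q\<close> is the probability of a
  deviation.\<close>

lemma bounded_reward_miss:
  "single_edge_strategy D p \<Longrightarrow> bounded_reward D (\<lambda>k u. 1 - p k u)"
  using strategyD[of D p] unfolding bounded_reward_def
  by (intro conjI ballI exI[of _ 1]) (auto)

text \<open>As \<open>p\<close> sums to 1, \<open>1 - p k u\<close> is the sum of
  \<open>p b u\<close> over the other indices, and its product with \<open>q k u\<close> vanishes
  term by term. So \<open>q\<close> puts mass only where \<open>p k u = 1\<close>.\<close>

lemma extreme_strategy_miss_zero:
  assumes p: "single_edge_strategy D p"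
    and ext: "extreme_measure_of (strategy_law D p) {strategy_law D q | q. single_edge_strategy D q}"
    and q: "single_edge_strategy D q" and eq: "strategy_law D q = strategy_law D p"
  shows "AE u in unif_cube D. \<forall>k\<in>{1..D}. q k u * (1 - p k u) = 0"
proof -
  have "AE u in unif_cube D. \<forall>a\<in>{1..D}. \<forall>b\<in>{1..D} - {a}. q a u * p b u = 0"
    using extreme_strategy_law_unique[OF p ext q eq] by (intro AE_ball_countable[THEN iffD2] ballI) (auto intro: countable_finite)
  then show ?thesis
  proof (rule AE_mp, intro AE_I2 impI ballI)
    fix u k assume u: "u \<in> space (unif_cube D)" and k: "k \<in> {1..D}"
      and 0: "\<forall>a\<in>{1..D}. \<forall>b\<in>{1..D} - {a}. q a u * p b u = 0"
    have "1 - p k u = (\<Sum>b\<in>{1..D} - {k}. p b u)"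
      using strategy_sum[OF p u] k by (simp add: sum_diff1)
    moreover have "(\<Sum>b\<in>{1..D} - {k}. q k u * p b u) = 0"
      using 0 k by (intro sum.neutral) blast
    ultimately show "q k u * (1 - p k u) = 0" by (simp only: sum_distrib_left)
  qed
qed

text \<open>Uniqueness applied to \<open>p\<close> itself: \<open>p k u * (1 - p k u) = 0\<close>
  leaves only the values 0 and 1, and the sum is 1.\<close>

lemma extreme_strategy_deterministic:
  assumes p: "single_edge_strategy D p"
    and ext: "extreme_measure_of (strategy_law D p) {strategy_law D q | q. single_edge_strategy D q}"
  shows "AE u in unif_cube D. \<exists>j\<in>{1..D}. \<forall>k\<in>{1..D}. p k u = (if k = j then 1 else 0)"
  using extreme_strategy_miss_zero[OF p ext p refl]
proof (rule AE_mp, intro AE_I2 impI)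
  fix u assume u: "u \<in> space (unif_cube D)" and "\<forall>k\<in>{1..D}. p k u * (1 - p k u) = 0"
  then have 01: "p k u = 0 \<or> p k u = 1" if "k \<in> {1..D}" for k using that by auto
  have "\<exists>j\<in>{1..D}. p j u \<noteq> 0"
    using strategy_sum[OF p u] by (metis sum.neutral zero_neq_one)
  then obtain j where j: "j \<in> {1..D}" "p j u = 1" using 01 by blast
  have "(\<Sum>k\<in>{1..D} - {j}. p k u) = 0"
    using strategy_sum[OF p u] j by (simp add: sum_diff1)
  then have "\<forall>k\<in>{1..D} - {j}. p k u = 0"
    using strategyD(2)[OF p _ u] by (subst (asm) sum_nonneg_eq_0_iff) auto
  with j show "\<exists>j\<in>{1..D}. \<forall>k\<in>{1..D}. p k u = (if k = j then 1 else 0)" by auto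
qed

text \<open>If every \<open>N\<close> had a counterexample, these would form decreasing nonempty
  convex sets, and a limit strategy would agree with \<open>p\<close> on all half-lines yet have
  mean miss at least \<delta>, against uniqueness. One parameter \<open>N\<close> governs both the
  number of tests and the tolerance, so that the sets are nested.\<close>

lemma extreme_strategy_stable:
  assumes p: "single_edge_strategy D p"
    and ext: "extreme_measure_of (strategy_law D p) {strategy_law D q | q. single_edge_strategy D q}"
    and "\<delta> > 0"
  shows "\<exists>N>0. \<forall>q. single_edge_strategy D q \<longrightarrow>
    (\<forall>m<N. \<bar>strategy_mean D q (half_line_test m) - strategy_mean D p (half_line_test m)\<bar> \<le> 1 / real N) \<longrightarrow>
    strategy_mean D q (\<lambda>k u. 1 - p k u) < \<delta>"
proof (rule ccontr)
  let ?\<Phi> = "\<lambda>q m. strategy_mean D q (half_line_test m)" and ?c = "\<lambda>k u. 1 - p k u"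
  note w = bounded_reward_half_line_test and c = bounded_reward_miss[OF p]
  \<comment> \<open>The shift to \<open>Suc N\<close> matches the claimed positivity of
    \<open>N\<close> and avoids a division by zero at the start of the sequence.\<close>
  define K where "K N = {q. single_edge_strategy D q \<and> (\<forall>m<Suc N. \<bar>?\<Phi> q m - ?\<Phi> p m\<bar> \<le> 1 / real (Suc N)) \<and>
      \<delta> \<le> strategy_mean D q ?c}" for N
  assume contra: "\<not> ?thesis"
  from contra have ne: "K N \<noteq> {}" for N
    unfolding K_def not_less[symmetric] using zero_less_Suc[of N] by blast
  have dec: "K (Suc N) \<subseteq> K N" for N
  proof
    fix q assume "q \<in> K (Suc N)"
    then have *: "single_edge_strategy D q" "\<And>m. m < Suc (Suc N) \<Longrightarrow> \<bar>?\<Phi> q m - ?\<Phi> p m\<bar> \<le> 1 / real (Suc (Suc N))"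
      "\<delta> \<le> strategy_mean D q ?c" unfolding K_def by auto
    have "1 / real (Suc (Suc N)) \<le> 1 / real (Suc N)" by (simp add: frac_le)
    then have "\<bar>?\<Phi> q m - ?\<Phi> p m\<bar> \<le> 1 / real (Suc N)" if "m < Suc N" for m
      using *(2)[of m] that by linarith
    with * show "q \<in> K N" unfolding K_def by blast
  qed
  have conv: "(\<lambda>k u. (1 - 1/2) * q k u + 1/2 * r k u) \<in> K N" if "q \<in> K N" "r \<in> K N" for N q r
  proof -
    from that have q: "single_edge_strategy D q" and r: "single_edge_strategy D r" by (auto simp: K_def)
    note mid = strategy_mean_convex_comb[OF q r, of _ "1/2"]
    have "\<bar>((1 - 1/2) * ?\<Phi> q m + 1/2 * ?\<Phi> r m) - ?\<Phi> p m\<bar> \<le> 1 / real (Suc N)" if "m < Suc N" for m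
    proof -
      have "\<bar>?\<Phi> q m - ?\<Phi> p m\<bar> \<le> 1 / real (Suc N)" "\<bar>?\<Phi> r m - ?\<Phi> p m\<bar> \<le> 1 / real (Suc N)"
        using \<open>q \<in> K N\<close> \<open>r \<in> K N\<close> that by (auto simp: K_def)
      then show ?thesis by argo
    qed
    moreover have "\<delta> \<le> (1 - 1/2) * strategy_mean D q ?c + 1/2 * strategy_mean D r ?c"
      using that by (auto simp: K_def)
    ultimately show ?thesis
      unfolding K_def using strategy_convex_comb[OF q r, of "1/2"] by (simp only: mem_Collect_eq mid[OF w] mid[OF c]) simp
  qed
  have strat: "single_edge_strategy D q" if "q \<in> K N" for q N using that by (auto simp: K_def)
  have "\<exists>q r. single_edge_strategy D r \<and> (\<forall>j. q j \<in> K j) \<and>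
      (AE u in unif_cube D. \<forall>k\<in>{1..D}. (\<lambda>j. q j k u) \<longlonglongrightarrow> r k u)"
    by (rule nested_convex_strategies_limit[where K = K, OF _ ne dec]) (erule strat, erule (1) conv)
  then obtain q r where r: "single_edge_strategy D r" and q: "\<And>j. q j \<in> K j"
    and lim: "AE u in unif_cube D. \<forall>k\<in>{1..D}. (\<lambda>j. q j k u) \<longlonglongrightarrow> r k u"
    by blast
  note tends = strategy_mean_tendsto[OF strat[OF q] r _ lim]
  have "?\<Phi> r m = ?\<Phi> p m" for m
  proof -
    have "(\<lambda>j. ?\<Phi> (q j) m - ?\<Phi> p m) \<longlonglongrightarrow> 0"
    proof (rule Lim_null_comparison)
      show "\<forall>\<^sub>F j in sequentially. norm (?\<Phi> (q j) m - ?\<Phi> p m) \<le> 1 / real (Suc j)"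
        using eventually_ge_at_top[of m] by eventually_elim (use q in \<open>auto simp: K_def\<close>)
      show "(\<lambda>j. 1 / real (Suc j)) \<longlonglongrightarrow> 0" using LIMSEQ_inverse_real_of_nat by (simp add: inverse_eq_divide)
    qed
    moreover have "(\<lambda>j. ?\<Phi> (q j) m - ?\<Phi> p m) \<longlonglongrightarrow> ?\<Phi> r m - ?\<Phi> p m"
      by (intro tendsto_diff tends w tendsto_const)
    ultimately show ?thesis using LIMSEQ_unique by fastforce
  qed
  then have "strategy_law D r = strategy_law D p" by (rule strategy_law_eqI[OF r p])
  from extreme_strategy_miss_zero[OF p ext r this] have "strategy_mean D r ?c = (\<integral>u. 0 \<partial>unif_cube D)"
    unfolding strategy_mean_def
    using strategy_mean_measurable[OF r c]
    by (intro integral_cong_AE) (auto elim!: eventually_mono intro!: sum.neutral simp del: mult_eq_0_iff)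
  moreover have "\<delta> \<le> strategy_mean D r ?c"
    by (rule LIMSEQ_le_const[OF tends[OF c]]) (use q in \<open>auto simp: K_def\<close>)
  ultimately show False using \<open>\<delta> > 0\<close> by simp
qed

text \<open>The coefficients come from the first-order condition at a near-maximiser of the mean miss
  minus a large multiple of the squared errors on the first \<open>N\<close> tests; this replaces a
  minimax theorem.\<close>
lemma extreme_strategy_multipliers:
  assumes p: "single_edge_strategy D p"
    and ext: "extreme_measure_of (strategy_law D p) {strategy_law D q | q. single_edge_strategy D q}"
    and "\<delta> > 0"
  shows "\<exists>N a. \<forall>q. single_edge_strategy D q \<longrightarrow>
    strategy_mean D q (\<lambda>k u. 1 - p k u)
      - (\<Sum>m<N. a m * (strategy_mean D q (half_line_test m) - strategy_mean D p (half_line_test m))) \<le> \<delta>"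
proof -
  define G where "G q = strategy_mean D q (\<lambda>k u. 1 - p k u)" for q
  define x where "x q m = strategy_mean D q (half_line_test m) - strategy_mean D p (half_line_test m)" for q m
  note w = bounded_reward_half_line_test and c = bounded_reward_miss[OF p]
  obtain N where N: "N > 0" and stable: "\<And>q. single_edge_strategy D q \<Longrightarrow> (\<And>m. m < N \<Longrightarrow> \<bar>x q m\<bar> \<le> 1 / real N) \<Longrightarrow> G q < \<delta> / 2"
    using extreme_strategy_stable[OF p ext, of "\<delta> / 2"] \<open>\<delta> > 0\<close> unfolding G_def x_def by auto
  \<comment> \<open>The strategy \<open>p\<close> has objective at least 0, so a near-maximiser pays
    a penalty of at most 2. With \<open>R = 2 * N\<^sup>2\<close> its squared errors sum to at most
    \<open>1 / N\<^sup>2\<close>, hence each error is at most \<open>1 / N\<close>, the tolerance at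
    which stability applies.\<close>
  define R :: real where "R = 2 * N\<^sup>2"
  define F where "F q = G q - R * (\<Sum>m<N. (x q m)\<^sup>2)" for q
  \<comment> \<open>The step length towards a competitor \<open>r\<close>: the quadratic remainder
    of the penalty is at most \<open>t\<^sup>2 * R * N\<close>, as test means lie in
    \<open>[0,1]\<close>. The accuracy \<open>e\<close> is chosen after \<open>t\<close> because it
    gets divided by \<open>t\<close>.\<close>
  define t where "t = min 1 (\<delta> / (4 * R * N))"
  define e where "e = min 1 (t * \<delta> / 4)"
  have R: "R > 0" using N by (simp add: R_def)
  have t: "0 < t" "t \<le> 1" "t * R * N \<le> \<delta> / 4"
    using R N \<open>\<delta> > 0\<close> by (auto simp: t_def min_def field_simps)
  have e: "0 < e" "e \<le> 1" "e / t \<le> \<delta> / 4" using t \<open>\<delta> > 0\<close> by (auto simp: e_def min_def field_simps)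
  have G: "0 \<le> G q" "G q \<le> 1" if "single_edge_strategy D q" for q
    using strategy_mean_range[OF that c, of 0 1] strategyD[OF p] unfolding G_def by auto
  have Fle: "F q \<le> 1" if "single_edge_strategy D q" for q
  proof -
    have "0 \<le> R * (\<Sum>m<N. (x q m)\<^sup>2)" using R by (intro mult_nonneg_nonneg sum_nonneg) auto
    with G(2)[OF that] show ?thesis by (simp add: F_def)
  qed
  have "Sup (F ` {q. single_edge_strategy D q}) - e < Sup (F ` {q. single_edge_strategy D q})"
    using e by simp
  then obtain q where q: "single_edge_strategy D q" and qe: "Sup (F ` {q. single_edge_strategy D q}) - e < F q"
    using p by (subst (asm) less_cSup_iff) (auto intro!: bdd_aboveI2[of _ _ 1] Fle)
  have near: "F r \<le> F q + e" if "single_edge_strategy D r" for r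
  proof -
    have "F r \<le> Sup (F ` {q. single_edge_strategy D q})"
      using that by (intro cSup_upper) (auto intro!: bdd_aboveI2[of _ _ 1] Fle)
    with qe show ?thesis by simp
  qed
  have "0 \<le> F p" using G(1)[OF p] by (simp add: F_def x_def)
  with near[OF p] e have "R * (\<Sum>m<N. (x q m)\<^sup>2) \<le> 2" using G(2)[OF q] by (simp add: F_def)
  then have sq: "(\<Sum>m<N. (x q m)\<^sup>2) \<le> 1 / N\<^sup>2" using N by (simp add: R_def field_simps)
  have "\<bar>x q m\<bar> \<le> 1 / real N" if "m < N" for m
  proof -
    have "(x q m)\<^sup>2 \<le> (\<Sum>m<N. (x q m)\<^sup>2)" using that by (intro member_le_sum) auto
    with sq have "(x q m)\<^sup>2 \<le> (1 / real N)\<^sup>2" by (simp add: power_divide)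
    then show ?thesis using power2_le_iff_abs_le[of "1 / real N" "x q m"] by simp
  qed
  then have Gq: "G q < \<delta> / 2" by (rule stable[OF q])
  \<comment> \<open>The partial derivatives of the penalty
    \<open>R * (\<Sum>m<N. (x q m)\<^sup>2)\<close> with respect to the errors
    \<open>x q m\<close>.\<close>
  define a where "a m = 2 * R * x q m" for m
  have "G r - (\<Sum>m<N. a m * x r m) \<le> \<delta>" if r: "single_edge_strategy D r" for r
  proof -
    let ?v = "\<lambda>k u. (1 - t) * q k u + t * r k u"
    have v: "single_edge_strategy D ?v" using t by (intro strategy_convex_comb q r) auto
    have Gv: "G ?v = (1 - t) * G q + t * G r"
      unfolding G_def by (rule strategy_mean_convex_comb[OF q r c])
    have xv: "x ?v m = x q m + t * (x r m - x q m)" for m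
      unfolding x_def strategy_mean_convex_comb[OF q r w] by (simp add: algebra_simps)
    define A B C where "A = (\<Sum>m<N. (x q m)\<^sup>2)" and "B = (\<Sum>m<N. x q m * x r m)"
      and "C = (\<Sum>m<N. (x r m - x q m)\<^sup>2)"
    have sqv: "(\<Sum>m<N. (x ?v m)\<^sup>2) = A + 2 * t * B - 2 * t * A + t\<^sup>2 * C"
      unfolding xv A_def B_def C_def
      by (simp add: power2_eq_square algebra_simps sum.distrib sum_subtractf sum_distrib_left)
    have aB: "(\<Sum>m<N. a m * x r m) = 2 * R * B"
      by (simp add: a_def B_def sum_distrib_left mult.assoc)
    have "0 \<le> A" by (simp add: A_def sum_nonneg)
    have "C \<le> (\<Sum>m<N. 1)" unfolding C_def
    proof (intro sum_mono)
      fix m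
      have "0 \<le> strategy_mean D s (half_line_test m)" "strategy_mean D s (half_line_test m) \<le> 1"
        if "single_edge_strategy D s" for s
        using strategy_mean_range[OF that w, of 0 m 1] by (auto simp: half_line_test_def split: split_indicator)
      from this[OF q] this[OF r] have "\<bar>x r m - x q m\<bar> \<le> 1" unfolding x_def by linarith
      then show "(x r m - x q m)\<^sup>2 \<le> 1" by (simp add: abs_square_le_1)
    qed
    then have "t\<^sup>2 * R * C \<le> t\<^sup>2 * R * N" using R by (intro mult_left_mono) auto
    moreover have "(1 - t) * G q + t * G r - R * (A + 2 * t * B - 2 * t * A + t\<^sup>2 * C) \<le> G q - R * A + e"
      using near[OF v] unfolding F_def sqv Gv A_def[symmetric] .
    \<comment> \<open>The objective at \<open>q\<close> is compared with that at the fraction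
      \<open>t\<close> of the way to \<open>r\<close>. On the right stand the near-maximality error,
      the small value \<open>G q\<close>, a term of favourable sign and the quadratic
      remainder.\<close>
    ultimately have "t * (G r - (\<Sum>m<N. a m * x r m)) \<le> e + t * G q - 2 * t * R * A + t\<^sup>2 * R * N"
      unfolding aB by (simp add: algebra_simps)
    also have "\<dots> \<le> t * (\<delta> / 4) + t * (\<delta> / 2) - 0 + t * (\<delta> / 4)"
    proof (intro add_mono diff_mono)
      show "e \<le> t * (\<delta> / 4)" by (simp add: e_def)
      show "t * G q \<le> t * (\<delta> / 2)" using t Gq by (intro mult_left_mono) auto
      show "0 \<le> 2 * t * R * A" using t R \<open>0 \<le> A\<close> by auto
      show "t\<^sup>2 * R * N \<le> t * (\<delta> / 4)"
        using mult_left_mono[OF t(3), of t] t by (simp add: power2_eq_square mult.assoc)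
    qed
    also have "\<dots> = t * \<delta>" by simp
    finally show ?thesis using t by simp
  qed
  then show ?thesis unfolding G_def x_def by blast
qed

text \<open>An inequality for the means of all strategies becomes a pointwise one when tested on the
  strategy that at each \<open>u\<close> maximises the miss minus the weighted tests: its mean is
  the integral of the pointwise maximum \<open>g\<close>, which dominates every \<open>k\<close> by
  construction.\<close>

lemma extreme_strategy_certificate:
  assumes D: "D \<ge> 1" and p: "single_edge_strategy D p"
    and ext: "extreme_measure_of (strategy_law D p) {strategy_law D q | q. single_edge_strategy D q}"
    and "\<delta> > 0"
  shows "\<exists>N a g B. g \<in> borel_measurable (unif_cube D) \<and> (\<forall>u\<in>space (unif_cube D). \<bar>g u\<bar> \<le> B) \<and>
    (\<forall>u\<in>space (unif_cube D). \<forall>k\<in>{1..D}. 1 - p k u \<le> g u + (\<Sum>m<N. a m * half_line_test m k u)) \<and>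
    (\<integral>u. g u \<partial>unif_cube D) + (\<Sum>m<N. a m * strategy_mean D p (half_line_test m)) \<le> \<delta>"
proof -
  obtain N :: nat and a where a: "\<And>q. single_edge_strategy D q \<Longrightarrow> strategy_mean D q (\<lambda>k u. 1 - p k u)
      - (\<Sum>m<N. a m * (strategy_mean D q (half_line_test m) - strategy_mean D p (half_line_test m))) \<le> \<delta>"
    using extreme_strategy_multipliers[OF p ext \<open>\<delta> > 0\<close>] by blast
  define w where "w k u = (1 - p k u) - (\<Sum>m<N. a m * half_line_test m k u)" for k u
  define g where "g u = Max ((\<lambda>k. w k u) ` {1..D})" for u
  define B where "B = 1 + (\<Sum>m<N. \<bar>a m\<bar>)"
  note ht = bounded_reward_half_line_test and c = bounded_reward_miss[OF p]
  have wm: "w k \<in> borel_measurable (unif_cube D)" if "k \<in> {1..D}" for k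
    using ht[of D] strategyD(1)[OF p that] that unfolding w_def[abs_def] bounded_reward_def
    by (intro borel_measurable_diff borel_measurable_sum borel_measurable_times borel_measurable_const) auto
  have wB: "\<bar>w k u\<bar> \<le> B" if k: "k \<in> {1..D}" and u: "u \<in> space (unif_cube D)" for k u
  proof -
    have "\<bar>\<Sum>m<N. a m * half_line_test m k u\<bar> \<le> (\<Sum>m<N. \<bar>a m\<bar>)"
      by (intro order.trans[OF sum_abs] sum_mono)
         (auto simp: half_line_test_def abs_mult split: split_indicator)
    then show ?thesis using strategyD(2,3)[OF p k u] unfolding w_def B_def by linarith
  qed
  have w: "bounded_reward D w" unfolding bounded_reward_def using wm wB by blast
  have gm: "g \<in> borel_measurable (unif_cube D)"
    unfolding g_def[abs_def] by (intro borel_measurable_Max wm) auto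
  have g_in: "g u \<in> (\<lambda>k. w k u) ` {1..D}" for u
    unfolding g_def using D by (intro Max_in) auto
  have g_ge: "w k u \<le> g u" if "k \<in> {1..D}" for k u
    unfolding g_def using that by (intro Max_ge) auto
  \<comment> \<open>Ties go to the smallest maximising index; this selection is a finite Boolean
    combination of the measurable events \<open>w l u = g u\<close>.\<close>
  define q where "q k u = (if w k u = g u \<and> (\<forall>l\<in>{1..<k}. w l u \<noteq> g u) then 1 else 0 :: real)" for k u
  have ex1: "\<exists>k0\<in>{1..D}. w k0 u = g u \<and> (\<forall>k\<in>{1..D}. q k u = (if k = k0 then 1 else 0))" for u
  proof -
    let ?P = "\<lambda>k. k \<in> {1..D} \<and> w k u = g u"
    define k0 where "k0 = (LEAST k. ?P k)"
    have "\<exists>k. ?P k" using g_in[of u] by force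
    then have k0: "?P k0" unfolding k0_def by (rule LeastI_ex)
    have least: "k0 \<le> k" if "?P k" for k unfolding k0_def using that by (rule Least_le)
    have "q k u = (if k = k0 then 1 else 0)" if "k \<in> {1..D}" for k
      using k0 least[of k] least that unfolding q_def by (cases k k0 rule: linorder_cases) force+
    with k0 show ?thesis by blast
  qed
  have q: "single_edge_strategy D q"
  proof (rule strategyI)
    fix k assume k: "k \<in> {1..D}"
    have "{u \<in> space (unif_cube D). w l u = g u} \<in> sets (unif_cube D)" if "l \<in> {1..D}" for l
      using wm[OF that] gm by measurable
    then have "{u \<in> space (unif_cube D). w k u = g u \<and> (\<forall>l\<in>{1..<k}. \<not> w l u = g u)} \<in> sets (unif_cube D)"
      using k by (intro sets.sets_Collect_conj sets.sets_Collect_finite_All sets.sets_Collect_neg) auto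
    then show "q k \<in> borel_measurable (unif_cube D)"
      unfolding q_def[abs_def] by (intro measurable_If) auto
  next
    fix u
    obtain k0 where "k0 \<in> {1..D}" "\<forall>k\<in>{1..D}. q k u = (if k = k0 then 1 else 0)" using ex1 by blast
    then show "(\<Sum>k\<in>{1..D}. q k u) = 1" by simp
  qed (simp add: q_def)
  have "(\<Sum>k\<in>{1..D}. q k u * w k u) = g u" for u
  proof -
    obtain k0 where k0: "k0 \<in> {1..D}" "w k0 u = g u" "\<forall>k\<in>{1..D}. q k u = (if k = k0 then 1 else 0)"
      using ex1 by blast
    have "(\<Sum>k\<in>{1..D}. q k u * w k u) = (\<Sum>k\<in>{1..D}. if k = k0 then g u else 0)"
      using k0 by (intro sum.cong) auto
    with k0 show ?thesis by simp
  qed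
  then have "(\<integral>u. g u \<partial>unif_cube D) = strategy_mean D q w" unfolding strategy_mean_def by simp
  also have "\<dots> = strategy_mean D q (\<lambda>k u. 1 - p k u) - (\<Sum>m<N. a m * strategy_mean D q (half_line_test m))"
    unfolding w_def[abs_def] by (rule strategy_mean_linear_sum[OF q c ht])
  finally have int: "(\<integral>u. g u \<partial>unif_cube D) + (\<Sum>m<N. a m * strategy_mean D p (half_line_test m)) \<le> \<delta>"
    using a[OF q] by (simp add: right_diff_distrib sum_subtractf)
  have bound: "\<bar>g u\<bar> \<le> B" if "u \<in> space (unif_cube D)" for u
  proof -
    obtain k where "k \<in> {1..D}" "g u = w k u" using g_in[of u] by (rule imageE)
    with wB[OF _ that] show ?thesis by simp
  qed
  have dom: "1 - p k u \<le> g u + (\<Sum>m<N. a m * half_line_test m k u)" if "k \<in> {1..D}" for k u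
    using g_ge[OF that, of u] unfolding w_def by linarith
  show ?thesis
    by (intro exI[of _ N] exI[of _ a] exI[of _ g] exI[of _ B] conjI ballI gm int bound dom)
qed

subsection \<open>Law of large numbers on the grid\<close>

text \<open>Disjoint blocks of an independent family are independent, and independence inside a
  block gives it the product law. A strategy sees a whole row at once, so averages over the grid are
  taken row by row.\<close>

lemma iid_uniform_grid_rows:
  assumes D: "D \<ge> 1" and U: "iid_uniform_grid M D U"
  shows "prob_space.indep_vars M (\<lambda>_. unif_cube D) (\<lambda>i \<omega>. \<lambda>j\<in>{1..D}. U i j \<omega>) UNIV"
    and "distr M (unif_cube D) (\<lambda>\<omega>. \<lambda>j\<in>{1..D}. U i j \<omega>) = unif_cube D"
proof -
  from U interpret prob_space M by (simp add: iid_uniform_grid_def)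
  let ?X = "\<lambda>(i, j). U i j"
  from U have ind: "indep_vars (\<lambda>_. unif01) ?X (UNIV \<times> {1..D})"
    and law: "\<And>i j. j \<in> {1..D} \<Longrightarrow> distr M unif01 (U i j) = unif01"
    by (auto simp: iid_uniform_grid_def)
  have rv: "U i j \<in> measurable M unif01" if "j \<in> {1..D}" for i j
    using ind that unfolding indep_vars_def by auto
  have Y: "(\<lambda>x. \<lambda>j\<in>{1..D}. x (i, j)) \<in> measurable (Pi\<^sub>M ({i} \<times> {1..D}) (\<lambda>_. unif01)) (unif_cube D)" for i :: nat
    by (intro measurable_restrict measurable_component_singleton) auto
  have "indep_vars (\<lambda>i. Pi\<^sub>M ({i} \<times> {1..D}) (\<lambda>_. unif01))
      (\<lambda>i \<omega>. restrict (\<lambda>z. ?X z \<omega>) ({i} \<times> {1..D})) UNIV"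
    by (intro indep_vars_restrict[OF ind]) (auto simp: disjoint_family_on_def)
  from indep_vars_compose2[OF this Y]
  show "indep_vars (\<lambda>_. unif_cube D) (\<lambda>i \<omega>. \<lambda>j\<in>{1..D}. U i j \<omega>) UNIV"
    by (simp cong: restrict_cong)
  let ?I = "{i} \<times> {1..D}"
  have ne: "?I \<noteq> {}" using D by auto
  have Xm: "(\<lambda>\<omega>. \<lambda>z\<in>?I. ?X z \<omega>) \<in> measurable M (Pi\<^sub>M ?I (\<lambda>_. unif01))"
    by (intro measurable_restrict) (auto intro: rv)
  have "indep_vars (\<lambda>_. unif01) ?X ?I" by (rule indep_vars_subset[OF ind]) auto
  then have "distr M (Pi\<^sub>M ?I (\<lambda>_. unif01)) (\<lambda>\<omega>. \<lambda>z\<in>?I. ?X z \<omega>) = Pi\<^sub>M ?I (\<lambda>z. distr M unif01 (?X z))"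
    by (subst (asm) indep_vars_iff_distr_eq_PiM'[OF ne]) (auto intro: rv)
  also have "\<dots> = Pi\<^sub>M ?I (\<lambda>_. unif01)" by (intro PiM_cong) (auto simp: law)
  finally have "distr M (Pi\<^sub>M ?I (\<lambda>_. unif01)) (\<lambda>\<omega>. \<lambda>z\<in>?I. ?X z \<omega>) = Pi\<^sub>M ?I (\<lambda>_. unif01)" .
  then have "distr (distr M (Pi\<^sub>M ?I (\<lambda>_. unif01)) (\<lambda>\<omega>. \<lambda>z\<in>?I. ?X z \<omega>)) (unif_cube D) (\<lambda>x. \<lambda>j\<in>{1..D}. x (i, j))
      = unif_cube D"
    using distr_PiM_reindex[of ?I "\<lambda>_. unif01" "\<lambda>j. (i, j)" "{1..D}"] prob_space_unif01
    by (simp add: inj_on_def)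
  then show "distr M (unif_cube D) (\<lambda>\<omega>. \<lambda>j\<in>{1..D}. U i j \<omega>) = unif_cube D"
    by (subst (asm) distr_distr[OF Y Xm]) (simp add: comp_def cong: restrict_cong)
qed

text \<open>For bounded \<open>g\<close>, Hoeffding's inequality makes deviations exponentially
  unlikely, hence summable, and Borel-Cantelli gives almost sure convergence.\<close>

lemma iid_uniform_grid_lln:
  assumes D: "D \<ge> 1" and U: "iid_uniform_grid M D U"
    and g: "g \<in> borel_measurable (unif_cube D)" and B: "\<And>u. u \<in> space (unif_cube D) \<Longrightarrow> \<bar>g u\<bar> \<le> B"
  shows "AE \<omega> in M. (\<lambda>n. (\<Sum>i<n. g (\<lambda>j\<in>{1..D}. U i j \<omega>)) / real n) \<longlonglongrightarrow> (\<integral>u. g u \<partial>unif_cube D)"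
proof -
  from U interpret prob_space M by (simp add: iid_uniform_grid_def)
  define V where "V i \<omega> = (\<lambda>j\<in>{1..D}. U i j \<omega>)" for i \<omega>
  note ind = iid_uniform_grid_rows(1)[OF D U, folded V_def]
    and law = iid_uniform_grid_rows(2)[OF D U, folded V_def]
  have V: "V i \<in> measurable M (unif_cube D)" for i
    using ind unfolding indep_vars_def by auto
  have gV: "(\<lambda>\<omega>. g (V i \<omega>)) \<in> borel_measurable M" for i by (rule measurable_compose[OF V g])
  have indg: "indep_vars (\<lambda>_. borel) (\<lambda>i \<omega>. g (V i \<omega>)) {..<n}" for n
    by (rule indep_vars_subset[OF indep_vars_compose2[OF ind g]]) auto
  have lawg: "distr M borel (\<lambda>\<omega>. g (V i \<omega>)) = distr (unif_cube D) borel g" for i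
    using distr_distr[OF g V[of i]] law[of i] by (simp add: comp_def)
  have mean: "expectation (\<lambda>\<omega>. g (V 0 \<omega>)) = (\<integral>u. g u \<partial>unif_cube D)"
    using integral_distr[OF V[of 0] g] law[of 0] by simp
  \<comment> \<open>The added 1 gives the range interval positive width, by which the exponent in
    Hoeffding's bound divides.\<close>
  define c where "c = \<bar>B\<bar> + 1"
  have "c > 0" by (simp add: c_def)
  have gc: "g (V i \<omega>) \<in> {- c..c}" if "\<omega> \<in> space M" for i \<omega>
    using B[OF measurable_space[OF V that]] unfolding c_def by (auto simp: abs_le_iff minus_le_iff)
      (smt (verit) abs_le_iff)+
  define \<mu> where "\<mu> = (\<integral>u. g u \<partial>unif_cube D)"
  define avg where "avg n \<omega> = (\<Sum>i<n. g (V i \<omega>)) / real n" for n \<omega>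
  have dev: "AE \<omega> in M. \<forall>\<^sub>F n in sequentially. \<bar>avg n \<omega> - \<mu>\<bar> < e" if "e > 0" for e
  proof -
    let ?A = "\<lambda>n. {\<omega> \<in> space M. \<bar>avg n \<omega> - \<mu>\<bar> \<ge> e}"
    define b where "b = exp (- 2 * e\<^sup>2 / (2 * c)\<^sup>2)"
    have A: "?A n \<in> sets M" for n unfolding avg_def using gV by measurable
    have le: "measure M (?A n) \<le> 2 * b ^ n" if "n > 0" for n
    proof -
      interpret Hoeffding_ineq_iid M "{..<n}" "\<lambda>i \<omega>. g (V i \<omega>)" "\<lambda>\<omega>. g (V 0 \<omega>)" "- c" c \<mu>
      proof unfold_locales
        show "AE \<omega> in M. g (V 0 \<omega>) \<in> {- c..c}" using gc by (intro AE_I2)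
        show "\<mu> \<equiv> expectation (\<lambda>\<omega>. g (V 0 \<omega>))" unfolding mean \<mu>_def .
      qed (auto simp: indg lawg gV)
      have "measure M (?A n) \<le> 2 * exp (- 2 * n * e\<^sup>2 / (2 * c)\<^sup>2)"
        using Hoeffding_ineq_abs_ge'[of e] \<open>e > 0\<close> \<open>c > 0\<close> \<open>n > 0\<close> unfolding avg_def
        by (simp add: lessThan_empty_iff)
      also have "exp (- 2 * n * e\<^sup>2 / (2 * c)\<^sup>2) = b ^ n"
        unfolding b_def by (simp add: exp_of_nat_mult[symmetric])
      finally show ?thesis .
    qed
    have "0 \<le> b" "b < 1" using \<open>e > 0\<close> \<open>c > 0\<close> by (auto simp: b_def)
    then have "summable (\<lambda>n. 2 * b ^ n)" by (intro summable_mult summable_geometric) auto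
    then have "summable (\<lambda>n. measure M (?A n))"
    proof (rule summable_comparison_test')
      show "norm (measure M (?A n)) \<le> 2 * b ^ n" if "1 \<le> n" for n using le[of n] that by simp
    qed
    then have "AE \<omega> in M. \<forall>\<^sub>F n in sequentially. \<omega> \<in> space M - ?A n"
      using A by (intro borel_cantelli_AE1) (auto simp: emeasure_eq_measure)
    then show ?thesis by eventually_elim (auto elim!: eventually_mono)
  qed
  have "AE \<omega> in M. \<forall>m. \<forall>\<^sub>F n in sequentially. \<bar>avg n \<omega> - \<mu>\<bar> < inverse (real (Suc m))"
    unfolding AE_all_countable by (intro allI dev) auto
  then have "AE \<omega> in M. (\<lambda>n. avg n \<omega>) \<longlonglongrightarrow> \<mu>"
  proof eventually_elim
    case (elim \<omega>)
    show ?case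
    proof (rule tendstoI)
      fix e :: real assume "e > 0"
      then obtain m where "inverse (real (Suc m)) < e" using reals_Archimedean by blast
      with elim[rule_format, of m] show "\<forall>\<^sub>F n in sequentially. dist (avg n \<omega>) \<mu> < e"
        by (auto simp: dist_real_def elim!: eventually_mono)
    qed
  qed
  then show ?thesis unfolding avg_def V_def \<mu>_def .
qed

subsection \<open>Empirical measures and the Levy-Prokhorov distance\<close>

lemma measure_empirical_measure:
  assumes A: "A \<in> sets unif01" and x: "\<And>i. i < n \<Longrightarrow> x i \<in> {0..1}"
  shows "measure (empirical_measure n x) A = (\<Sum>i<n. indicator A (x i)) / real n"
proof -
  have m: "x \<in> measurable (uniform_count_measure {..<n}) unif01"
    using x by (auto simp: measurable_def sets_uniform_count_measure space_uniform_count_measure)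
  have "x -` A \<inter> {..<n} = {i \<in> {..<n}. x i \<in> A}" by auto
  then have "measure (empirical_measure n x) A = card {i \<in> {..<n}. x i \<in> A} / real n"
    unfolding empirical_measure_def measure_distr[OF m A] space_uniform_count_measure
    by (subst measure_uniform_count_measure) auto
  also have "real (card {i \<in> {..<n}. x i \<in> A}) = (\<Sum>i\<in>{i \<in> {..<n}. x i \<in> A}. 1)" by simp
  also have "\<dots> = (\<Sum>i<n. if x i \<in> A then 1 else 0)" by (rule sum.inter_filter) simp
  also have "\<dots> = (\<Sum>i<n. indicator A (x i))" by (intro sum.cong) auto
  finally show ?thesis .
qed

lemma sets_empirical_measure [simp]: "sets (empirical_measure n x) = sets unif01"
  by (simp add: empirical_measure_def)

lemma space_empirical_measure [simp]: "space (empirical_measure n x) = {0..1}"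
  by (simp add: empirical_measure_def)

lemma prob_space_empirical_measure:
  assumes "n > 0" "\<And>i. i < n \<Longrightarrow> x i \<in> {0..1}"
  shows "prob_space (empirical_measure n x)"
  unfolding empirical_measure_def
  using assms by (intro prob_space.prob_space_distr prob_space_uniform_count_measure)
    (auto simp: measurable_def sets_uniform_count_measure space_uniform_count_measure lessThan_empty_iff)

definition lp_close :: "'a::metric_space measure \<Rightarrow> 'a measure \<Rightarrow> real \<Rightarrow> bool" where
  "lp_close \<mu> \<nu> e \<longleftrightarrow> 0 < e \<and>
     (\<forall>A\<in>sets \<mu>. measure \<mu> A \<le> measure \<nu> ((\<Union>a\<in>A. ball a e) \<inter> space \<mu>) + e \<and>
                  measure \<nu> A \<le> measure \<mu> ((\<Union>a\<in>A. ball a e) \<inter> space \<mu>) + e)"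

lemma levy_prokhorov_eq: "levy_prokhorov \<mu> \<nu> = Inf {e. lp_close \<mu> \<nu> e}"
  by (simp add: levy_prokhorov_def lp_close_def)

text \<open>Makes the infimum in the distance run over a nonempty set. At \<open>n = 0\<close> the
  empirical measure is null rather than a probability measure, which is why \<open>n > 0\<close>
  recurs below.\<close>

lemma lp_close_1:
  assumes "prob_space \<mu>" "prob_space \<nu>"
  shows "lp_close \<mu> \<nu> 1"
  using prob_space.prob_le_1[OF assms(1)] prob_space.prob_le_1[OF assms(2)]
  by (auto simp: lp_close_def intro: order.trans[OF _ le_add_same_cancel2[THEN iffD2]])

lemma levy_prokhorov_nonneg:
  assumes "prob_space \<mu>" "prob_space \<nu>"
  shows "0 \<le> levy_prokhorov \<mu> \<nu>"
  unfolding levy_prokhorov_eq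
proof (rule cInf_greatest)
  show "{e. lp_close \<mu> \<nu> e} \<noteq> {}" using lp_close_1[OF assms] by blast
qed (auto simp: lp_close_def)

lemma levy_prokhorov_le: "lp_close \<mu> \<nu> e \<Longrightarrow> levy_prokhorov \<mu> \<nu> \<le> e"
  unfolding levy_prokhorov_eq by (intro cInf_lower bdd_belowI[of _ 0]) (auto simp: lp_close_def)

lemma levy_prokhorov_lessD:
  assumes "prob_space \<mu>" "prob_space \<nu>" "levy_prokhorov \<mu> \<nu> < e"
  shows "\<exists>e'<e. lp_close \<mu> \<nu> e'"
  using cInf_lessD[of "{e. lp_close \<mu> \<nu> e}" e] lp_close_1[OF assms(1,2)] assms(3)
  unfolding levy_prokhorov_eq by auto

text \<open>For \<open>K > 0\<close> the half-open interval \<open>[j/K, (j+1)/K)\<close>. Covering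
  \<open>[0,1]\<close> takes \<open>K + 1\<close> of these, since the point 1 has index
  \<open>K\<close>; hence the tolerances with \<open>Suc K\<close>.\<close>

definition cell :: "nat \<Rightarrow> nat \<Rightarrow> real set" where
  "cell K j = {x. \<lfloor>real K * x\<rfloor> = int j}"

lemma sets_cell [measurable]: "cell K j \<in> sets borel"
  unfolding cell_def by measurable

text \<open>Strictness places a whole cell inside the open ball of radius \<open>1 / real K\<close>
  around any of its points.\<close>

lemma cell_diam:
  assumes "K > 0" "x \<in> cell K j" "y \<in> cell K j"
  shows "dist x y < 1 / real K"
proof -
  have "\<bar>real K * x - real K * y\<bar> < 1"
    using assms(2,3) unfolding cell_def by (auto simp: floor_eq_iff)
  then have "real K * \<bar>x - y\<bar> < 1" by (simp add: right_diff_distrib[symmetric] abs_mult)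
  then show ?thesis using \<open>K > 0\<close> by (simp add: dist_real_def field_simps)
qed

lemma cells_cover:
  assumes "x \<in> {0..1}"
  shows "\<exists>j\<le>K. x \<in> cell K j"
proof -
  have "0 \<le> real K * x" "real K * x \<le> real K" using assms by (auto intro: mult_left_le)
  then have "0 \<le> \<lfloor>real K * x\<rfloor>" "\<lfloor>real K * x\<rfloor> \<le> int K" by (auto simp: floor_le_iff)
  then show ?thesis unfolding cell_def by (intro exI[of _ "nat \<lfloor>real K * x\<rfloor>"]) auto
qed

text \<open>The cells that meet \<open>A\<close> cover it and lie in its thickening, as points of
  one cell are less than \<open>e\<close> apart. There are at most \<open>Suc K\<close> of them,
  each costing \<open>e / real (Suc K)\<close>.\<close>

lemma measure_le_thickening:
  assumes fin: "finite_measure \<mu>" "finite_measure \<nu>"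
    and s: "sets \<mu> = sets unif01" "sets \<nu> = sets unif01"
    and K: "K > 0" "1 / real K \<le> e"
    and le: "\<And>j. j \<le> K \<Longrightarrow> measure \<mu> (cell K j \<inter> {0..1}) \<le> measure \<nu> (cell K j \<inter> {0..1}) + e / real (Suc K)"
    and A: "A \<in> sets unif01"
  shows "measure \<mu> A \<le> measure \<nu> ((\<Union>a\<in>A. ball a e) \<inter> {0..1}) + e"
proof -
  interpret m: finite_measure \<mu> by fact
  interpret n: finite_measure \<nu> by fact
  let ?c = "\<lambda>j. cell K j \<inter> {0..1}"
  have c: "?c j \<in> sets unif01" for j by simp
  have "e > 0" using K by (meson divide_pos_pos less_le_trans of_nat_0_less_iff zero_less_one)
  define J where "J = {j \<in> {..K}. A \<inter> cell K j \<noteq> {}}"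
  have J: "finite J" "card J \<le> Suc K" "\<And>j. j \<in> J \<Longrightarrow> j \<le> K"
    using card_mono[of "{..K}" J] by (auto simp: J_def)
  have "A \<subseteq> {0..1}" using A by (simp add: sets_unif01_iff)
  have "A \<subseteq> (\<Union>j\<in>J. ?c j)"
  proof
    fix x assume "x \<in> A"
    then obtain j where "j \<le> K" "x \<in> cell K j" using cells_cover[of x K] \<open>A \<subseteq> {0..1}\<close> by blast
    with \<open>x \<in> A\<close> \<open>A \<subseteq> {0..1}\<close> show "x \<in> (\<Union>j\<in>J. ?c j)" unfolding J_def by auto
  qed
  then have "measure \<mu> A \<le> measure \<mu> (\<Union>j\<in>J. ?c j)"
    using A J by (intro m.finite_measure_mono) (auto simp: s)
  also have "\<dots> \<le> (\<Sum>j\<in>J. measure \<mu> (?c j))"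
    using J by (intro measure_UNION_le) (auto simp: s)
  also have "\<dots> \<le> (\<Sum>j\<in>J. measure \<nu> (?c j) + e / real (Suc K))"
    using J le by (intro sum_mono) auto
  also have "\<dots> = (\<Sum>j\<in>J. measure \<nu> (?c j)) + card J * (e / real (Suc K))"
    by (simp add: sum.distrib)
  also have "(\<Sum>j\<in>J. measure \<nu> (?c j)) = measure \<nu> (\<Union>j\<in>J. ?c j)"
    using J by (intro n.finite_measure_finite_Union[symmetric])
      (auto simp: s disjoint_family_on_def cell_def)
  also have "\<dots> \<le> measure \<nu> ((\<Union>a\<in>A. ball a e) \<inter> {0..1})"
  proof (intro n.finite_measure_mono)
    show "(\<Union>j\<in>J. ?c j) \<subseteq> (\<Union>a\<in>A. ball a e) \<inter> {0..1}"
    proof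
      fix x assume "x \<in> (\<Union>j\<in>J. ?c j)"
      then obtain j a where "x \<in> cell K j" "x \<in> {0..1}" "a \<in> A" "a \<in> cell K j" unfolding J_def by auto
      with cell_diam[OF K(1), of a j x] K(2) show "x \<in> (\<Union>a\<in>A. ball a e) \<inter> {0..1}" by force
    qed
    show "(\<Union>a\<in>A. ball a e) \<inter> {0..1} \<in> sets \<nu>"
      unfolding s by (intro borel_Int_unif01 borel_open open_UN) auto
  qed
  also have "card J * (e / real (Suc K)) \<le> real (Suc K) * (e / real (Suc K))"
    using J(2) \<open>e > 0\<close> by (intro mult_right_mono) auto
  finally show ?thesis by simp
qed

lemma levy_prokhorov_le_cells:
  assumes fin: "finite_measure \<mu>" "finite_measure \<nu>"
    and s: "sets \<mu> = sets unif01" "sets \<nu> = sets unif01"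
    and K: "K > 0" "1 / real K \<le> e"
    and le: "\<And>j. j \<le> K \<Longrightarrow> \<bar>measure \<mu> (cell K j \<inter> {0..1}) - measure \<nu> (cell K j \<inter> {0..1})\<bar> \<le> e / real (Suc K)"
  shows "levy_prokhorov \<mu> \<nu> \<le> e"
proof (rule levy_prokhorov_le)
  have "e > 0" using K by (meson divide_pos_pos less_le_trans of_nat_0_less_iff zero_less_one)
  have "space \<mu> = {0..1}" using sets_eq_imp_space_eq[OF s(1)] by simp
  moreover have "measure \<mu> (cell K j \<inter> {0..1}) \<le> measure \<nu> (cell K j \<inter> {0..1}) + e / real (Suc K)"
    "measure \<nu> (cell K j \<inter> {0..1}) \<le> measure \<mu> (cell K j \<inter> {0..1}) + e / real (Suc K)" if "j \<le> K" for j
    using le[OF that] by linarith+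
  ultimately show "lp_close \<mu> \<nu> e"
    unfolding lp_close_def using \<open>e > 0\<close> s measure_le_thickening[OF fin s K] measure_le_thickening[OF fin(2,1) s(2,1) K]
    by auto
qed

text \<open>Thickening a half-line by \<open>e\<close> moves its end point by at most
  \<open>e\<close>; the Lipschitz bound prices this shift at \<open>c * e\<close>, and the additive
  error gives one more \<open>e\<close>. The bound is asked of \<nu> alone because \<mu> will be an
  empirical measure, which has atoms.\<close>

lemma lp_close_cdf:
  assumes fin: "finite_measure \<mu>" "finite_measure \<nu>"
    and s: "sets \<mu> = sets unif01" "sets \<nu> = sets unif01"
    and lip: "\<And>x y. x \<le> y \<Longrightarrow> measure \<nu> ({..y} \<inter> {0..1}) \<le> measure \<nu> ({..x} \<inter> {0..1}) + c * (y - x)"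
    and e: "lp_close \<mu> \<nu> e"
  shows "\<bar>measure \<mu> ({..r} \<inter> {0..1}) - measure \<nu> ({..r} \<inter> {0..1})\<bar> \<le> (c + 1) * e"
proof -
  interpret m: finite_measure \<mu> by fact
  interpret n: finite_measure \<nu> by fact
  have sp: "space \<mu> = {0..1}" using sets_eq_imp_space_eq[OF s(1)] by simp
  have "0 < e" using e by (simp add: lp_close_def)
  have thick: "(\<Union>a\<in>{..x} \<inter> {0..1}. ball a e) \<inter> {0..1} \<subseteq> {..x + e} \<inter> {0..1}" for x
    by (auto simp: dist_real_def)
  have cl: "measure \<mu> ({..x} \<inter> {0..1}) \<le> measure \<nu> ({..x + e} \<inter> {0..1}) + e"
    "measure \<nu> ({..x} \<inter> {0..1}) \<le> measure \<mu> ({..x + e} \<inter> {0..1}) + e" for x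
  proof -
    have "{..x} \<inter> {0..1} \<in> sets \<mu>" unfolding s by (intro borel_Int_unif01) auto
    with e have *: "measure \<mu> ({..x} \<inter> {0..1}) \<le> measure \<nu> ((\<Union>a\<in>{..x} \<inter> {0..1}. ball a e) \<inter> {0..1}) + e"
      "measure \<nu> ({..x} \<inter> {0..1}) \<le> measure \<mu> ((\<Union>a\<in>{..x} \<inter> {0..1}. ball a e) \<inter> {0..1}) + e"
      unfolding lp_close_def sp by blast+
    have "{..x + e} \<inter> {0..1} \<in> sets unif01" by (intro borel_Int_unif01) auto
    then have "measure \<nu> ((\<Union>a\<in>{..x} \<inter> {0..1}. ball a e) \<inter> {0..1}) \<le> measure \<nu> ({..x + e} \<inter> {0..1})"
      "measure \<mu> ((\<Union>a\<in>{..x} \<inter> {0..1}. ball a e) \<inter> {0..1}) \<le> measure \<mu> ({..x + e} \<inter> {0..1})"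
      using thick[of x] by (auto intro!: m.finite_measure_mono n.finite_measure_mono simp only: s)
    with * show "measure \<mu> ({..x} \<inter> {0..1}) \<le> measure \<nu> ({..x + e} \<inter> {0..1}) + e"
      "measure \<nu> ({..x} \<inter> {0..1}) \<le> measure \<mu> ({..x + e} \<inter> {0..1}) + e" by linarith+
  qed
  show ?thesis
    using cl(1)[of r] cl(2)[of "r - e"] lip[of r "r + e"] lip[of "r - e" r] \<open>0 < e\<close>
    by (auto simp: abs_le_iff algebra_simps)
qed

section \<open>Ranks in the sorted list of values\<close>

lemma length_sorted_image_mset:
  assumes "finite P"
  shows "length (sorted_list_of_multiset (image_mset f (mset_set P))) = card P"
  by (metis mset_sorted_list_of_multiset size_image_mset size_mset size_mset_set)

lemma kth_smallest_lessD:
  assumes "finite P" "1 \<le> k" "kth_smallest k f P < ereal x"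
  shows "k \<le> card {\<pi> \<in> P. f \<pi> < x}"
proof -
  let ?M = "image_mset f (mset_set P)"
  let ?xs = "sorted_list_of_multiset ?M"
  have k: "k \<le> length ?xs" "?xs ! (k - 1) < x"
    using assms(3) length_sorted_image_mset[OF assms(1), of f] by (auto simp: kth_smallest_def split: if_splits)
  have "{..<k} \<subseteq> {i. i < length ?xs \<and> ?xs ! i < x}"
  proof (intro subsetI CollectI conjI)
    fix i assume "i \<in> {..<k}"
    then show "i < length ?xs" using k by simp
    have "?xs ! i \<le> ?xs ! (k - 1)"
      using \<open>i \<in> {..<k}\<close> k assms(2) by (intro sorted_nth_mono) auto
    with k show "?xs ! i < x" by simp
  qed
  then have "k \<le> card {i. i < length ?xs \<and> ?xs ! i < x}"
    using card_mono[of "{i. i < length ?xs \<and> ?xs ! i < x}" "{..<k}"] by simp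
  also have "\<dots> = length (filter (\<lambda>y. y < x) ?xs)" by (simp add: length_filter_conv_card)
  also have "\<dots> = size (filter_mset (\<lambda>y. y < x) ?M)"
    by (metis mset_filter mset_sorted_list_of_multiset size_mset)
  also have "\<dots> = card {\<pi> \<in> P. f \<pi> < x}"
    using assms(1) by (simp add: filter_mset_image_mset filter_mset_mset_set)
  finally show ?thesis .
qed

lemma kth_smallest_1:
  assumes "finite P" "\<pi> \<in> P"
  shows "kth_smallest 1 f P \<le> ereal (f \<pi>)"
    and "(\<And>\<pi>. \<pi> \<in> P \<Longrightarrow> 0 \<le> f \<pi>) \<Longrightarrow> 0 \<le> kth_smallest 1 f P"
proof -
  let ?xs = "sorted_list_of_multiset (image_mset f (mset_set P))"
  have set: "set ?xs = f ` P" using assms by simp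
  have "card P \<ge> 1" using assms by (metis One_nat_def Suc_leI card_gt_0_iff empty_iff)
  then have eq: "kth_smallest 1 f P = ereal (?xs ! 0)" and len: "0 < length ?xs"
    using length_sorted_image_mset[OF assms(1), of f] by (auto simp: kth_smallest_def)
  have "f \<pi> \<in> set ?xs" using set assms by simp
  then obtain i where "i < length ?xs" "?xs ! i = f \<pi>" unfolding in_set_conv_nth by blast
  then have "?xs ! 0 \<le> f \<pi>" using sorted_nth_mono[of ?xs 0 i] by simp
  then show "kth_smallest 1 f P \<le> ereal (f \<pi>)" using eq by simp
  assume "\<And>\<pi>. \<pi> \<in> P \<Longrightarrow> 0 \<le> f \<pi>"
  moreover have "?xs ! 0 \<in> f ` P" using nth_mem[OF len] set by simp
  ultimately show "0 \<le> kth_smallest 1 f P" using eq by auto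
qed

subsection \<open>Counting paths close to an extreme law\<close>

lemma finite_grid_paths: "finite (grid_paths D n)"
  unfolding grid_paths_def by (intro finite_PiE) auto

text \<open>An exponential Markov inequality: each path is weighted by \<open>exp (- b)\<close> per
  miss. Summed over all paths the weights factor into rows, where one index has weight 1 and each
  other index has weight \<open>exp (- b)\<close>.\<close>

lemma card_paths_few_misses:
  fixes b s :: real
  assumes det: "\<And>i. i < n \<Longrightarrow> \<exists>j\<in>{1..D}. \<forall>k\<in>{1..D}. x i k = (if k = j then 1 else 0 :: real)"
    and "b \<ge> 0"
  shows "real (card {\<pi> \<in> grid_paths D n. (\<Sum>i<n. 1 - x i (\<pi> i)) \<le> s}) \<le> exp (b * s + n * (D * exp (- b)))"
proof -
  let ?S = "{\<pi> \<in> grid_paths D n. (\<Sum>i<n. 1 - x i (\<pi> i)) \<le> s}"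
  have row: "(\<Sum>k\<in>{1..D}. exp (- b * (1 - x i k))) \<le> exp (D * exp (- b))" if i: "i < n" for i
  proof -
    obtain j where j: "j \<in> {1..D}" "\<And>k. k \<in> {1..D} \<Longrightarrow> x i k = (if k = j then 1 else 0)"
      using det[OF i] by blast
    have "(\<Sum>k\<in>{1..D}. exp (- b * (1 - x i k))) \<le> (\<Sum>k\<in>{1..D}. (if k = j then 1 else 0) + exp (- b))"
      using j(2) by (intro sum_mono) auto
    also have "\<dots> = 1 + D * exp (- b)" using j(1) by (simp add: sum.distrib)
    also have "\<dots> \<le> exp (D * exp (- b))" by (rule exp_ge_add_one_self)
    finally show ?thesis .
  qed
  have "card ?S * exp (- b * s) = (\<Sum>\<pi>\<in>?S. exp (- b * s))" by simp
  also have "\<dots> \<le> (\<Sum>\<pi>\<in>?S. \<Prod>i<n. exp (- b * (1 - x i (\<pi> i))))"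
  proof (intro sum_mono)
    fix \<pi> assume "\<pi> \<in> ?S"
    then have "b * (\<Sum>i<n. 1 - x i (\<pi> i)) \<le> b * s" using \<open>b \<ge> 0\<close> by (intro mult_left_mono) auto
    then show "exp (- b * s) \<le> (\<Prod>i<n. exp (- b * (1 - x i (\<pi> i))))"
      by (simp add: exp_sum[symmetric] sum_distrib_left[symmetric] sum_negf)
  qed
  also have "\<dots> \<le> (\<Sum>\<pi>\<in>grid_paths D n. \<Prod>i<n. exp (- b * (1 - x i (\<pi> i))))"
    by (intro sum_mono2 finite_grid_paths) (auto intro: prod_nonneg)
  also have "\<dots> = (\<Prod>i<n. \<Sum>k\<in>{1..D}. exp (- b * (1 - x i k)))"
    unfolding grid_paths_def by (rule prod_sum_PiE[symmetric]) auto
  also have "\<dots> \<le> (\<Prod>i<n. exp (D * exp (- b)))"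
    using row by (intro prod_mono conjI sum_nonneg) simp_all
  also have "\<dots> = exp (n * (D * exp (- b)))" by (simp add: exp_of_nat_mult)
  finally have "card ?S \<le> exp (n * (D * exp (- b))) / exp (- b * s)"
    by (simp add: pos_le_divide_eq)
  also have "\<dots> = exp (b * s + n * (D * exp (- b)))"
    by (simp add: exp_diff[symmetric] add.commute)
  finally show ?thesis .
qed

lemma AE_rows:
  assumes D: "D \<ge> 1" and U: "iid_uniform_grid M D U" and P: "AE u in unif_cube D. P u"
  shows "AE \<omega> in M. \<forall>i. P (\<lambda>j\<in>{1..D}. U i j \<omega>)"
proof -
  from U interpret prob_space M by (simp add: iid_uniform_grid_def)
  have "(\<lambda>\<omega>. \<lambda>j\<in>{1..D}. U i j \<omega>) \<in> measurable M (unif_cube D)" for i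
    using iid_uniform_grid_rows(1)[OF D U] unfolding indep_vars_def by auto
  moreover have "AE u in distr M (unif_cube D) (\<lambda>\<omega>. \<lambda>j\<in>{1..D}. U i j \<omega>). P u" for i
    unfolding iid_uniform_grid_rows(2)[OF D U] by (rule P)
  ultimately have "AE \<omega> in M. P (\<lambda>j\<in>{1..D}. U i j \<omega>)" for i by (rule AE_distrD)
  then show ?thesis by (simp add: AE_all_countable)
qed

lemma empirical_measure_path:
  assumes \<pi>: "\<pi> \<in> grid_paths D n" and n: "n > 0"
    and V: "\<And>i. (\<lambda>j\<in>{1..D}. U i j \<omega>) \<in> space (unif_cube D)"
  shows "prob_space (empirical_measure n (\<lambda>i. U i (\<pi> i) \<omega>))"
    and "A \<in> sets borel \<Longrightarrow> measure (empirical_measure n (\<lambda>i. U i (\<pi> i) \<omega>)) (A \<inter> {0..1})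
      = (\<Sum>i<n. indicator A ((\<lambda>j\<in>{1..D}. U i j \<omega>) (\<pi> i))) / n"
proof -
  have in01: "U i (\<pi> i) \<omega> \<in> {0..1}" and \<pi>D: "\<pi> i \<in> {1..D}" if "i < n" for i
  proof -
    show "\<pi> i \<in> {1..D}" using \<pi> that by (auto simp: grid_paths_def PiE_iff)
    from unif_cube_coord_range[OF V this] this show "U i (\<pi> i) \<omega> \<in> {0..1}" by simp
  qed
  show "prob_space (empirical_measure n (\<lambda>i. U i (\<pi> i) \<omega>))"
    by (rule prob_space_empirical_measure[OF n in01])
  assume A: "A \<in> sets borel"
  have "measure (empirical_measure n (\<lambda>i. U i (\<pi> i) \<omega>)) (A \<inter> {0..1})
      = (\<Sum>i<n. indicator (A \<inter> {0..1}) (U i (\<pi> i) \<omega>)) / n"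
    by (rule measure_empirical_measure[OF _ in01]) (use A in simp)
  also have "(\<Sum>i<n. indicator (A \<inter> {0..1}) (U i (\<pi> i) \<omega>))
      = (\<Sum>i<n. (indicator A ((\<lambda>j\<in>{1..D}. U i j \<omega>) (\<pi> i)) :: real))"
    using in01 \<pi>D by (intro sum.cong) (auto split: split_indicator)
  finally show "measure (empirical_measure n (\<lambda>i. U i (\<pi> i) \<omega>)) (A \<inter> {0..1})
      = (\<Sum>i<n. indicator A ((\<lambda>j\<in>{1..D}. U i j \<omega>) (\<pi> i))) / n" .
qed

text \<open>The witness takes in every row the index selected by \<open>p\<close>. Closeness is
  reduced to the masses of finitely many cells, so countably many laws of large numbers suffice for
  all radii.\<close>

lemma min_levy_prokhorov_tendsto_0:
  assumes D: "D \<ge> 1" and U: "iid_uniform_grid M D U" and p: "single_edge_strategy D p"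
    and det: "AE u in unif_cube D. \<exists>j\<in>{1..D}. \<forall>k\<in>{1..D}. p k u = (if k = j then 1 else 0)"
  shows "AE \<omega> in M. (\<lambda>n. kth_smallest 1
            (\<lambda>\<pi>. levy_prokhorov (empirical_measure n (\<lambda>i. U i (\<pi> i) \<omega>)) (strategy_law D p))
            (grid_paths D n)) \<longlonglongrightarrow> 0"
proof -
  define V where "V i \<omega> = (\<lambda>j\<in>{1..D}. U i j \<omega>)" for i \<omega>
  let ?\<sigma> = "strategy_law D p"
  \<comment> \<open>Given the row \<open>u\<close>, the conditional probability that the chosen
    weight falls into the cell. Because \<open>p\<close> is deterministic this is an indicator, so
    row averages of \<open>h\<close> equal the empirical cell masses along the witness.\<close>
  define h where "h K j u = (\<Sum>k\<in>{1..D}. p k u * indicator (cell K j) (u k))" for K j u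
  have hI: "(\<integral>u. h K j u \<partial>unif_cube D) = measure ?\<sigma> (cell K j \<inter> {0..1})" for K j
    unfolding h_def using measure_strategy_law[OF p sets_cell] by (simp add: strategy_mean_def)
  have "AE \<omega> in M. (\<lambda>n. (\<Sum>i<n. h K j (V i \<omega>)) / real n) \<longlonglongrightarrow> measure ?\<sigma> (cell K j \<inter> {0..1})" for K j
    unfolding V_def hI[symmetric]
  proof (rule iid_uniform_grid_lln[OF D U])
    show "h K j \<in> borel_measurable (unif_cube D)"
      unfolding h_def[abs_def] by (rule strategy_mean_measurable[OF p bounded_reward_indicator[OF sets_cell]])
    fix u assume u: "u \<in> space (unif_cube D)"
    have "0 \<le> (indicator (cell K j) (u k) :: real) \<and> indicator (cell K j) (u k) \<le> (1::real)" for k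
      by (auto split: split_indicator)
    from strategy_mean_bounds[OF p u, where w = "\<lambda>k u. indicator (cell K j) (u k)", OF this]
    show "\<bar>h K j u\<bar> \<le> 1" unfolding h_def by linarith
  qed
  then have lln: "AE \<omega> in M. \<forall>K j. (\<lambda>n. (\<Sum>i<n. h K j (V i \<omega>)) / real n) \<longlonglongrightarrow> measure ?\<sigma> (cell K j \<inter> {0..1})"
    by (simp add: AE_all_countable)
  have rows: "AE \<omega> in M. \<forall>i. V i \<omega> \<in> space (unif_cube D)"
    unfolding V_def by (rule AE_rows[OF D U AE_space])
  have "AE \<omega> in M. \<forall>i. \<exists>j\<in>{1..D}. \<forall>k\<in>{1..D}. p k (V i \<omega>) = (if k = j then 1 else 0)"
    unfolding V_def by (rule AE_rows[OF D U det])
  with lln rows show ?thesis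
  proof eventually_elim
    case (elim \<omega>)
    obtain J where J: "\<And>i. J i \<in> {1..D}" "\<And>i k. k \<in> {1..D} \<Longrightarrow> p k (V i \<omega>) = (if k = J i then 1 else 0)"
      using elim(3) by metis
    define \<pi> where "\<pi> n = restrict J {..<n}" for n
    have \<pi>: "\<pi> n \<in> grid_paths D n" for n using J(1) by (auto simp: \<pi>_def grid_paths_def)
    let ?e = "\<lambda>n \<pi>. empirical_measure n (\<lambda>i. U i (\<pi> i) \<omega>)"
    have Vs: "(\<lambda>j\<in>{1..D}. U i j \<omega>) \<in> space (unif_cube D)" for i using elim(2) by (simp add: V_def)
    have emp: "prob_space (?e n \<pi>)"
      and empm: "A \<in> sets borel \<Longrightarrow> measure (?e n \<pi>) (A \<inter> {0..1}) = (\<Sum>i<n. indicator A (V i \<omega> (\<pi> i))) / n"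
      if "\<pi> \<in> grid_paths D n" "n > 0" for n \<pi> A
      unfolding V_def using empirical_measure_path[OF that, where U = U and \<omega> = \<omega>, OF Vs] by auto
    have h: "h K j (V i \<omega>) = indicator (cell K j) (V i \<omega> (J i))" for K j i
    proof -
      have "h K j (V i \<omega>) = (\<Sum>k\<in>{1..D}. if k = J i then indicator (cell K j) (V i \<omega> k) else 0)"
        unfolding h_def using J(2) by (intro sum.cong) auto
      then show ?thesis using J(1) by simp
    qed
    have cellm: "measure (?e n (\<pi> n)) (cell K j \<inter> {0..1}) = (\<Sum>i<n. h K j (V i \<omega>)) / n" if "n > 0" for n K j
      unfolding empm[OF \<pi> that sets_cell] h by (simp add: \<pi>_def V_def)
    have LP: "(\<lambda>n. levy_prokhorov (?e n (\<pi> n)) ?\<sigma>) \<longlonglongrightarrow> 0"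
    proof (rule tendstoI)
      fix e :: real assume "e > 0"
      then obtain K0 where "inverse (real (Suc K0)) < e / 2" using reals_Archimedean[of "e / 2"] by auto
      then obtain K :: nat where K: "K > 0" "1 / real K \<le> e / 2" by (metis inverse_eq_divide less_imp_le zero_less_Suc)
      have "\<forall>\<^sub>F n in sequentially. \<forall>j\<in>{..K}. dist ((\<Sum>i<n. h K j (V i \<omega>)) / real n) (measure ?\<sigma> (cell K j \<inter> {0..1})) < (e / 2) / real (Suc K)"
        using elim(1) \<open>e > 0\<close> by (intro eventually_ball_finite ballI tendstoD) auto
      then show "\<forall>\<^sub>F n in sequentially. dist (levy_prokhorov (?e n (\<pi> n)) ?\<sigma>) 0 < e"
        using eventually_gt_at_top[of 0]
      proof eventually_elim
        case (elim n)
        interpret e: prob_space "?e n (\<pi> n)" by (rule emp[OF \<pi> elim(2)])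
        interpret s: prob_space ?\<sigma> by (rule prob_space_strategy_law[OF p])
        have "levy_prokhorov (?e n (\<pi> n)) ?\<sigma> \<le> e / 2"
          using elim by (intro levy_prokhorov_le_cells[OF e.finite_measure_axioms s.finite_measure_axioms _ _ K])
            (auto simp: cellm dist_real_def intro: less_imp_le)
        moreover have "0 \<le> levy_prokhorov (?e n (\<pi> n)) ?\<sigma>"
          by (rule levy_prokhorov_nonneg[OF e.prob_space_axioms s.prob_space_axioms])
        ultimately show ?case using \<open>e > 0\<close> by simp
      qed
    qed
    show ?case
    proof (rule tendsto_sandwich[where f = "\<lambda>_. 0" and h = "\<lambda>n. ereal (levy_prokhorov (?e n (\<pi> n)) ?\<sigma>)"])
      show "(\<lambda>n. ereal (levy_prokhorov (?e n (\<pi> n)) ?\<sigma>)) \<longlonglongrightarrow> 0"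
        using tendsto_ereal[OF LP] by (simp add: zero_ereal_def)
      show "\<forall>\<^sub>F n in sequentially. kth_smallest 1 (\<lambda>\<pi>. levy_prokhorov (?e n \<pi>) ?\<sigma>) (grid_paths D n)
          \<le> ereal (levy_prokhorov (?e n (\<pi> n)) ?\<sigma>)"
        by (intro always_eventually allI kth_smallest_1(1) finite_grid_paths \<pi>)
      show "\<forall>\<^sub>F n in sequentially. 0 \<le> kth_smallest 1 (\<lambda>\<pi>. levy_prokhorov (?e n \<pi>) ?\<sigma>) (grid_paths D n)"
        using eventually_gt_at_top[of 0]
        by eventually_elim
          (intro kth_smallest_1(2)[OF finite_grid_paths \<pi>] levy_prokhorov_nonneg
             emp prob_space_strategy_law[OF p])
    qed auto
  qed
qed

text \<open>The radius \<open>e\<close> is fixed by \<alpha> and the certificate before any outcome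
  \<omega> is drawn; only the threshold for \<open>n\<close> is random, through the row averages of
  \<open>g\<close>. Close paths miss rarely, and such paths are counted by
  \<open>card_paths_few_misses\<close>.\<close>

lemma few_paths_near_extreme_law:
  fixes \<alpha> :: real
  assumes D: "D \<ge> 1" and U: "iid_uniform_grid M D U" and p: "single_edge_strategy D p"
    and ext: "extreme_measure_of (strategy_law D p) {strategy_law D q | q. single_edge_strategy D q}"
    and "\<alpha> > 0"
  shows "\<exists>e>0. AE \<omega> in M. \<forall>\<^sub>F n in sequentially.
    real (card {\<pi> \<in> grid_paths D n.
        levy_prokhorov (empirical_measure n (\<lambda>i. U i (\<pi> i) \<omega>)) (strategy_law D p) < e}) \<le> exp (\<alpha> * n)"
proof -
  define V where "V i \<omega> = (\<lambda>j\<in>{1..D}. U i j \<omega>)" for i \<omega>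
  let ?\<sigma> = "strategy_law D p"
  \<comment> \<open>The exponent of the path count has two parts, each granted half of \<alpha>:
    \<open>b\<close> makes \<open>D * exp (- b)\<close> small, and \<delta> is then tuned so that
    \<open>b * (3 * \<delta>) = \<alpha> / 2\<close>. The lower bound 1 keeps \<open>b\<close>
    positive.\<close>
  define b where "b = max 1 (ln (2 * D / \<alpha>))"
  have b: "b \<ge> 1" "D * exp (- b) \<le> \<alpha> / 2"
  proof -
    show "b \<ge> 1" by (simp add: b_def)
    have "exp (- b) \<le> exp (- ln (2 * D / \<alpha>))" by (simp add: b_def)
    also have "\<dots> = \<alpha> / (2 * D)" using D \<open>\<alpha> > 0\<close> by (simp add: exp_minus)
    finally show "D * exp (- b) \<le> \<alpha> / 2" using D by (simp add: field_simps)
  qed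
  define \<delta> where "\<delta> = \<alpha> / (6 * b)"
  have \<delta>: "\<delta> > 0" "b * (3 * \<delta>) = \<alpha> / 2" using b \<open>\<alpha> > 0\<close> by (auto simp: \<delta>_def)
  obtain N a g B where g: "g \<in> borel_measurable (unif_cube D)"
    and gB: "\<And>u. u \<in> space (unif_cube D) \<Longrightarrow> \<bar>g u\<bar> \<le> B"
    and dom: "\<And>u k. u \<in> space (unif_cube D) \<Longrightarrow> k \<in> {1..D} \<Longrightarrow>
        1 - p k u \<le> g u + (\<Sum>m<N. a m * half_line_test m k u)"
    and int: "(\<integral>u. g u \<partial>unif_cube D) + (\<Sum>m<N. a m * strategy_mean D p (half_line_test m)) \<le> \<delta>"
    using extreme_strategy_certificate[OF D p ext \<open>\<delta> > 0\<close>] by blast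
  let ?\<Phi> = "\<lambda>m. strategy_mean D p (half_line_test m)"
  \<comment> \<open>Passing from the empirical measure to the law costs
    \<open>(real D + 1) * e\<close> per half-line, with \<open>D\<close> the Lipschitz constant;
    weighted by \<open>\<bar>a m\<bar>\<close> this totals \<open>c * e\<close>.\<close>
  define c where "c = (real D + 1) * (\<Sum>m<N. \<bar>a m\<bar>)"
  have "c \<ge> 0" by (auto simp: c_def intro!: mult_nonneg_nonneg sum_nonneg)
  define e where "e = \<delta> / (c + 1)"
  have e: "e > 0" "c * e \<le> \<delta>" using \<open>c \<ge> 0\<close> \<open>\<delta> > 0\<close> by (auto simp: e_def field_simps)
  have lln: "AE \<omega> in M. (\<lambda>n. (\<Sum>i<n. g (V i \<omega>)) / real n) \<longlonglongrightarrow> (\<integral>u. g u \<partial>unif_cube D)"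
    unfolding V_def by (rule iid_uniform_grid_lln[OF D U g gB])
  have rows: "AE \<omega> in M. \<forall>i. V i \<omega> \<in> space (unif_cube D)"
    unfolding V_def by (rule AE_rows[OF D U AE_space])
  have "AE \<omega> in M. \<forall>i. \<exists>j\<in>{1..D}. \<forall>k\<in>{1..D}. p k (V i \<omega>) = (if k = j then 1 else 0)"
    unfolding V_def by (rule AE_rows[OF D U extreme_strategy_deterministic[OF p ext]])
  with lln rows have "AE \<omega> in M. \<forall>\<^sub>F n in sequentially.
    real (card {\<pi> \<in> grid_paths D n.
        levy_prokhorov (empirical_measure n (\<lambda>i. U i (\<pi> i) \<omega>)) ?\<sigma> < e}) \<le> exp (\<alpha> * n)"
  proof eventually_elim
    case (elim \<omega>)
    let ?e = "\<lambda>n \<pi>. empirical_measure n (\<lambda>i. U i (\<pi> i) \<omega>)"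
    have Vs: "(\<lambda>j\<in>{1..D}. U i j \<omega>) \<in> space (unif_cube D)" for i using elim(2) by (simp add: V_def)
    note det = elim(3)[rule_format]
    have "\<forall>\<^sub>F n in sequentially. (\<Sum>i<n. g (V i \<omega>)) / real n < (\<integral>u. g u \<partial>unif_cube D) + \<delta>"
      using elim(1) \<open>\<delta> > 0\<close> by (intro order_tendstoD(2)) auto
    then show ?case
      using eventually_gt_at_top[of 0]
    proof eventually_elim
      case (elim n)
      have avg: "(\<Sum>i<n. g (V i \<omega>)) \<le> n * ((\<integral>u. g u \<partial>unif_cube D) + \<delta>)"
        using elim by (simp add: pos_divide_less_eq mult.commute)
      have misses: "(\<Sum>i<n. 1 - p (\<pi> i) (V i \<omega>)) \<le> 3 * \<delta> * n"
        if \<pi>: "\<pi> \<in> grid_paths D n" and lp: "levy_prokhorov (?e n \<pi>) ?\<sigma> < e" for \<pi>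
      proof -
        interpret e: prob_space "?e n \<pi>"
          by (rule empirical_measure_path(1)[OF \<pi> elim(2), where U = U and \<omega> = \<omega>, OF Vs])
        interpret s: prob_space ?\<sigma> by (rule prob_space_strategy_law[OF p])
        from levy_prokhorov_lessD[OF e.prob_space_axioms s.prob_space_axioms lp]
        obtain e' where e': "e' < e" "lp_close (?e n \<pi>) ?\<sigma> e'" by blast
        have close: "\<bar>(\<Sum>i<n. half_line_test m (\<pi> i) (V i \<omega>)) / n - ?\<Phi> m\<bar> \<le> (real D + 1) * e" for m
        proof -
          let ?H = "{..real_of_rat (nat_to_rat_surj m)}"
          have "\<bar>measure (?e n \<pi>) (?H \<inter> {0..1}) - measure ?\<sigma> (?H \<inter> {0..1})\<bar> \<le> (real D + 1) * e'"
            by (rule lp_close_cdf[OF e.finite_measure_axioms s.finite_measure_axioms _ _ _ e'(2)])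
              (rule sets_empirical_measure sets_strategy_law strategy_law_cdf_Lipschitz(2)[OF p]; assumption?)+
          also have "\<dots> \<le> (real D + 1) * e" using e' by (intro mult_left_mono) auto
          finally show ?thesis
            using empirical_measure_path(2)[OF \<pi> elim(2), where U = U and \<omega> = \<omega> and A = ?H, OF Vs] measure_strategy_law[OF p, of ?H]
            by (simp add: half_line_test_def[abs_def] V_def)
        qed
        have "(\<Sum>i<n. 1 - p (\<pi> i) (V i \<omega>))
            \<le> (\<Sum>i<n. g (V i \<omega>) + (\<Sum>m<N. a m * half_line_test m (\<pi> i) (V i \<omega>)))"
          using \<pi> Vs by (intro sum_mono dom) (auto simp: grid_paths_def PiE_iff V_def)
        also have "\<dots> = (\<Sum>i<n. g (V i \<omega>)) + n * (\<Sum>m<N. a m * ((\<Sum>i<n. half_line_test m (\<pi> i) (V i \<omega>)) / n))"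
          using elim(2) by (simp add: sum.distrib sum.swap[of _ "{..<N}"] flip: sum_distrib_left sum_divide_distrib)
        also have "(\<Sum>m<N. a m * ((\<Sum>i<n. half_line_test m (\<pi> i) (V i \<omega>)) / n))
            \<le> (\<Sum>m<N. a m * ?\<Phi> m + \<bar>a m\<bar> * ((real D + 1) * e))"
        proof (intro sum_mono)
          fix m
          let ?d = "(\<Sum>i<n. half_line_test m (\<pi> i) (V i \<omega>)) / n - ?\<Phi> m"
          have "a m * ?d \<le> \<bar>a m\<bar> * \<bar>?d\<bar>" by (simp flip: abs_mult)
          also have "\<dots> \<le> \<bar>a m\<bar> * ((real D + 1) * e)" by (intro mult_left_mono close) auto
          finally show "a m * ((\<Sum>i<n. half_line_test m (\<pi> i) (V i \<omega>)) / n)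
              \<le> a m * ?\<Phi> m + \<bar>a m\<bar> * ((real D + 1) * e)" by (simp add: right_diff_distrib)
        qed
        also have "\<dots> = (\<Sum>m<N. a m * ?\<Phi> m) + c * e"
          unfolding sum.distrib sum_distrib_right[symmetric] c_def by (simp add: mult_ac)
        finally have "(\<Sum>i<n. 1 - p (\<pi> i) (V i \<omega>))
            \<le> n * ((\<integral>u. g u \<partial>unif_cube D) + \<delta>) + n * ((\<Sum>m<N. a m * ?\<Phi> m) + c * e)"
          using avg elim(2) by (simp add: mult_left_mono)
        also have "\<dots> = n * ((\<integral>u. g u \<partial>unif_cube D) + (\<Sum>m<N. a m * ?\<Phi> m) + \<delta> + c * e)"
          by (simp add: algebra_simps)
        also have "\<dots> \<le> n * (3 * \<delta>)" using int e by (intro mult_left_mono) auto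
        finally show ?thesis by (simp add: mult.commute)
      qed
      have "card {\<pi> \<in> grid_paths D n. levy_prokhorov (?e n \<pi>) ?\<sigma> < e}
          \<le> card {\<pi> \<in> grid_paths D n. (\<Sum>i<n. 1 - p (\<pi> i) (V i \<omega>)) \<le> 3 * \<delta> * n}"
        using misses by (intro card_mono) (auto intro: finite_subset[OF _ finite_grid_paths])
      then have "real (card {\<pi> \<in> grid_paths D n. levy_prokhorov (?e n \<pi>) ?\<sigma> < e})
          \<le> exp (b * (3 * \<delta> * n) + n * (D * exp (- b)))"
        using card_paths_few_misses[of n D "\<lambda>i k. p k (V i \<omega>)" b "3 * \<delta> * n"] det b(1)
        by simp
      also have "b * (3 * \<delta> * n) + n * (D * exp (- b)) \<le> \<alpha> * n"
      proof -
        have "n * (D * exp (- b)) \<le> n * (\<alpha> / 2)" using b(2) by (intro mult_left_mono) auto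
        moreover have "b * (3 * \<delta> * n) = \<alpha> / 2 * n" using \<delta>(2) by (simp flip: mult.assoc)
        ultimately have "b * (3 * \<delta> * n) + n * (D * exp (- b)) \<le> \<alpha> / 2 * n + n * (\<alpha> / 2)" by linarith
        also have "\<dots> = \<alpha> * n" by simp
        finally show ?thesis .
      qed
      finally show ?case by simp
    qed
  qed
  with \<open>e > 0\<close> show ?thesis by blast
qed

text \<open>Taking the integer part of \<open>exp (\<alpha> * real n)\<close> loses less than 1.
  This gap keeps the rank strictly above a path count that grows at rate at most \<alpha> /
  2.\<close>

lemma eventually_exp_gap:
  fixes \<alpha> :: real
  assumes "\<alpha> > 0"
  shows "\<forall>\<^sub>F n in sequentially. exp (\<alpha> / 2 * real n) \<le> exp (\<alpha> * real n) - 1"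
proof -
  obtain n0 :: nat where "2 / \<alpha> < n0" using reals_Archimedean2 by blast
  show ?thesis
    using eventually_ge_at_top[of n0]
  proof eventually_elim
    case (elim n)
    let ?y = "exp (\<alpha> / 2 * real n)"
    have "2 / \<alpha> \<le> n" using elim \<open>2 / \<alpha> < n0\<close> by linarith
    then have "1 \<le> \<alpha> / 2 * n" using assms by (simp add: field_simps)
    then have "2 \<le> ?y" using exp_ge_add_one_self[of "\<alpha> / 2 * n"] by linarith
    moreover have "exp (\<alpha> * real n) = ?y * ?y" by (simp flip: exp_add)
    moreover have "2 * ?y \<le> ?y * ?y" using \<open>2 \<le> ?y\<close> by (intro mult_right_mono) auto
    ultimately show ?case by linarith
  qed
qed

theorem theoremC:
  fixes M :: "'w measure" and U :: "nat \<Rightarrow> nat \<Rightarrow> 'w \<Rightarrow> real"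
    and D :: nat and p :: "nat \<Rightarrow> (nat \<Rightarrow> real) \<Rightarrow> real"
  assumes "D \<ge> 1"
    and "iid_uniform_grid M D U"
    and "single_edge_strategy D p"
    and "extreme_measure_of (strategy_law D p) {strategy_law D q | q. single_edge_strategy D q}"
  shows "grid_entropy M D U (strategy_law D p) = 0"
proof -
  from assms(2) interpret prob_space M by (simp add: iid_uniform_grid_def)
  let ?f = "\<lambda>\<omega> n \<pi>. levy_prokhorov (empirical_measure n (\<lambda>i. U i (\<pi> i) \<omega>)) (strategy_law D p)"
  let ?E = "\<lambda>\<alpha>. AE \<omega> in M. (\<lambda>n. kth_smallest (nat \<lfloor>exp (\<alpha> * real n)\<rfloor>) (?f \<omega> n) (grid_paths D n)) \<longlonglongrightarrow> 0"
  \<comment> \<open>At \<alpha> = 0 the rank is 1 for every \<open>n\<close>, so the claim concerns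
    the minimum over all paths.\<close>
  have zero: "?E 0"
    using min_levy_prokhorov_tendsto_0[OF assms(1-3) extreme_strategy_deterministic[OF assms(3,4)]]
    unfolding mult_zero_left exp_zero floor_one nat_one_as_int[symmetric] nat_1 One_nat_def .
  \<comment> \<open>Convergence at rate \<alpha> would put at least
    \<open>nat \<lfloor>exp (\<alpha> * real n)\<rfloor>\<close> paths within any fixed radius for
    large \<open>n\<close>, against the count bounded at rate \<alpha> / 2.\<close>
  have pos: "\<not> ?E \<alpha>" if "\<alpha> > 0" for \<alpha>
  proof
    assume conv: "?E \<alpha>"
    obtain e where "e > 0" and few: "AE \<omega> in M. \<forall>\<^sub>F n in sequentially.
        real (card {\<pi> \<in> grid_paths D n. ?f \<omega> n \<pi> < e}) \<le> exp (\<alpha> / 2 * n)"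
      using few_paths_near_extreme_law[OF assms, where \<alpha> = "\<alpha> / 2"] \<open>\<alpha> > 0\<close> by auto
    from conv few have "AE \<omega> in M. False"
    proof eventually_elim
      case (elim \<omega>)
      have "\<forall>\<^sub>F n in sequentially. kth_smallest (nat \<lfloor>exp (\<alpha> * real n)\<rfloor>) (?f \<omega> n) (grid_paths D n) < ereal e"
        using elim(1) \<open>e > 0\<close> by (intro order_tendstoD(2)) auto
      then have "\<forall>\<^sub>F n :: nat in sequentially. False"
        using elim(2) eventually_exp_gap[OF \<open>\<alpha> > 0\<close>] eventually_gt_at_top[of 0]
      proof eventually_elim
        case (elim n)
        let ?k = "nat \<lfloor>exp (\<alpha> * real n)\<rfloor>"
        have "exp (\<alpha> * real n) \<ge> 1" using \<open>\<alpha> > 0\<close> by simp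
        then have "1 \<le> ?k" "exp (\<alpha> * real n) - 1 < real ?k" by linarith+
        moreover have "?k \<le> card {\<pi> \<in> grid_paths D n. ?f \<omega> n \<pi> < e}"
          by (rule kth_smallest_lessD[OF finite_grid_paths \<open>1 \<le> ?k\<close> elim(1)])
        ultimately show False using elim(2,3) by linarith
      qed
      then show False by simp
    qed
    then show False by simp
  qed
  have "{\<alpha>. 0 \<le> \<alpha> \<and> ?E \<alpha>} = {0}"
  proof (intro equalityI subsetI)
    fix \<alpha> assume "\<alpha> \<in> {\<alpha>. 0 \<le> \<alpha> \<and> ?E \<alpha>}"
    then have *: "0 \<le> \<alpha> \<and> ?E \<alpha>" by (rule CollectD)
    have "\<not> 0 < \<alpha>"
    proof
      assume "0 < \<alpha>"
      from pos[OF this] conjunct2[OF *] show False by (rule notE)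
    qed
    with conjunct1[OF *] show "\<alpha> \<in> {0}" by simp
  next
    fix \<alpha> :: real assume "\<alpha> \<in> {0}"
    then have "\<alpha> = 0" by simp
    show "\<alpha> \<in> {\<alpha>. 0 \<le> \<alpha> \<and> ?E \<alpha>}" unfolding \<open>\<alpha> = 0\<close>
      by (rule CollectI, rule conjI[OF order.refl zero])
  qed
  then show ?thesis unfolding grid_entropy_def by (simp only: image_insert image_empty) (simp add: zero_ereal_def)
qed

end
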